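(* Let $\mathcal{I}$ be an $\mathcal{R}$-monoid, let $\mathcal{S} \subseteq \mathcal{P}(\mathbb{N})$ be closed under subsets, and let $\mathcal{L}$ be a class of languages. The following are equivalent: (1) there is a learner $h\in\mathcal I$ that $\mathbf{Txt}\mathbf{Psd}\mathbf{Wb}\mathbf{Ex}$-learns every $L\in\mathcal L$ and that, on every text $T\in\mathbf{Txt}(\mathcal S)$, is defined (i.e. $\mathbf{Psd}(h,T)$ is total) and satisfies $\mathbf{Wb}(\mathbf{Psd}(h,T),T)$; (2) there is a learner $h\in\mathcal I$ that $\mathbf{Txt}\mathbf{Psd}\mathbf{Caut}_{\mathbf{Tar}}\mathbf{Ex}$-learns every $L\in\mathcal L$ and that is defined on every text $T\in\mathbf{Txt}(\mathcal S)$.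
   Context: Fix an acceptable numbering $(\varphi_e)$ of partial computable functions, $W_e=\mathrm{dom}(\varphi_e)$. A text is a total function $T:\mathbb N\to\mathbb N\cup\{\#\}$, $\mathrm{content}(T)=\mathrm{range}(T)\setminus\{\#\}$, $T[n]=(T(0),\dots,T(n-1))$; $\mathbf{Txt}(L)$ is the set of texts with content $L$, and for $\mathcal S$ closed under subsets $\mathbf{Txt}(\mathcal S)=\bigcup_{S\in\mathcal S}\mathbf{Txt}(S)$. Learners are partial computable functions; the partially set-driven interaction operator is $\mathbf{Psd}(h,T)(i)=h(\mathrm{content}(T[i]),i)$ (the learner sees the finite set of data so far and the number of data items presented). For total $p:\mathbb N\to\mathbb N$ and a text $T$: $\mathbf{Ex}(p,T)$ iff $\exists n_0\,\forall n\ge n_0: p(n)=p(n_0)\wedge W_{p(n_0)}=\mathrm{content}(T)$; $\mathbf{Wb}(p,T)$ iff for all $n,m$: if there is $k$ with $n\le k\le m$ and $p(n)\ne p(k)$, then $(\mathrm{content}(T[m])\cap W_{p(m)})\setminus W_{p(n)}\ne\emptyset$; $\mathbf{Caut}_{\mathbf{Tar}}(p,T)$ iff for no $n$ is $\mathrm{content}(T)\subsetneq W_{p(n)}$. $h$ $\mathbf{Txt}\beta\delta\mathbf{Ex}$-learns $L$ iff for every $T\in\mathbf{Txt}(L)$, $\beta(h,T)$ is total and $\delta(\beta(h,T),T)$ and $\mathbf{Ex}(\beta(h,T),T)$ hold. $\mathcal R$ is the set of total computable functions; $\mathcal I\subseteq$ (partial computable functions) is an $\mathcal R$-monoid iff $(\mathcal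 I,\circ)$ is a monoid and $\mathcal R\subseteq\mathcal I$. *)

theory Defs
  imports Main "HOL-Library.Nat_Bijection"
begin

text \<open>Partial functions N -> N are modelled as nat => nat option (None = undefined).
Pairs are coded with the Cantor pairing prod_encode. The basis follows the standard
unary presentation (zero, succ, left, right, pair, comp, prec, rfind).\<close>

definition pcomp :: "(nat \<Rightarrow> nat option) \<Rightarrow> (nat \<Rightarrow> nat option) \<Rightarrow> nat \<Rightarrow> nat option"
  where "pcomp f g = (\<lambda>x. Option.bind (g x) f)"

fun prec_aux :: "(nat \<Rightarrow> nat option) \<Rightarrow> (nat \<Rightarrow> nat option) \<Rightarrow> nat \<Rightarrow> nat \<Rightarrow> nat option" where
  "prec_aux f g a 0 = f a"
| "prec_aux f g a (Suc n) =
     Option.bind (prec_aux f g a n) (\<lambda>r. g (prod_encode (a, prod_encode (n, r))))"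

definition rfind :: "(nat \<Rightarrow> nat option) \<Rightarrow> nat \<Rightarrow> nat option" where
  "rfind f = (\<lambda>a. if \<exists>n. f (prod_encode (a, n)) = Some 0
                          \<and> (\<forall>m<n. \<exists>k. f (prod_encode (a, m)) = Some (Suc k))
                  then Some (LEAST n. f (prod_encode (a, n)) = Some 0
                          \<and> (\<forall>m<n. \<exists>k. f (prod_encode (a, m)) = Some (Suc k)))
                  else None)"

inductive_set partrec :: "(nat \<Rightarrow> nat option) set" where
  zero: "(\<lambda>x. Some 0) \<in> partrec"
| succ: "(\<lambda>x. Some (Suc x)) \<in> partrec"
| left: "(\<lambda>x. Some (fst (prod_decode x))) \<in> partrec"
| right: "(\<lambda>x. Some (snd (prod_decode x))) \<in> partrec"
| pair: "f \<in> partrec \<Longrightarrow> g \<in> partrec \<Longrightarrow>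
     (\<lambda>x. Option.bind (f x) (\<lambda>a. Option.bind (g x) (\<lambda>b. Some (prod_encode (a, b))))) \<in> partrec"
| comp: "f \<in> partrec \<Longrightarrow> g \<in> partrec \<Longrightarrow> pcomp f g \<in> partrec"
| prec: "f \<in> partrec \<Longrightarrow> g \<in> partrec \<Longrightarrow>
     (\<lambda>x. prec_aux f g (fst (prod_decode x)) (snd (prod_decode x))) \<in> partrec"
| rfind: "f \<in> partrec \<Longrightarrow> rfind f \<in> partrec"

definition Rfun :: "(nat \<Rightarrow> nat option) set" where
  "Rfun = {f \<in> partrec. \<forall>x. f x \<noteq> None}"

definition R_monoid :: "(nat \<Rightarrow> nat option) set \<Rightarrow> bool" where
  "R_monoid I \<longleftrightarrow> I \<subseteq> partrec \<and> (\<lambda>x. Some x) \<in> I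
     \<and> (\<forall>f\<in>I. \<forall>g\<in>I. pcomp f g \<in> I) \<and> Rfun \<subseteq> I"

text \<open>A numbering phi (phi e = e-th partial function) is acceptable: it lists exactly the
partial computable functions, its universal function is computable, and it has the
s-m-n property (Rogers' characterisation of acceptable numberings).\<close>
definition acceptable :: "(nat \<Rightarrow> nat \<Rightarrow> nat option) \<Rightarrow> bool" where
  "acceptable \<phi> \<longleftrightarrow>
     (\<lambda>x. \<phi> (fst (prod_decode x)) (snd (prod_decode x))) \<in> partrec
   \<and> (\<forall>f\<in>partrec. \<exists>e. \<phi> e = f)
   \<and> (\<exists>s. (\<lambda>x. Some (s x)) \<in> partrec \<and>
        (\<forall>e x y. \<phi> (s (prod_encode (e, x))) y = \<phi> e (prod_encode (x, y))))"

definition W :: "(nat \<Rightarrow> nat \<Rightarrow> nat option) \<Rightarrow> nat \<Rightarrow> nat set" where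
  "W \<phi> e = {x. \<phi> e x \<noteq> None}"

text \<open>A text is a total function nat => nat option, None playing the role of the pause #.\<close>
type_synonym textseq = "nat \<Rightarrow> nat option"

definition content :: "textseq \<Rightarrow> nat set" where
  "content T = {x. \<exists>n. T n = Some x}"

definition content_init :: "textseq \<Rightarrow> nat \<Rightarrow> nat set" where
  "content_init T n = {x. \<exists>i<n. T i = Some x}"

definition Txt :: "nat set \<Rightarrow> textseq set" where
  "Txt L = {T. content T = L}"

definition TxtS :: "nat set set \<Rightarrow> textseq set" where
  "TxtS \<S> = (\<Union>S\<in>\<S>. Txt S)"

definition subset_closed :: "nat set set \<Rightarrow> bool" where
  "subset_closed \<S> \<longleftrightarrow> (\<forall>A\<in>\<S>. \<forall>B. B \<subseteq> A \<longrightarrow> B \<in> \<S>)"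

definition set_code :: "nat set \<Rightarrow> nat" where
  "set_code D = (\<Sum>x\<in>D. 2 ^ x)"

definition Psd :: "(nat \<Rightarrow> nat option) \<Rightarrow> textseq \<Rightarrow> nat \<Rightarrow> nat option" where
  "Psd h T i = h (prod_encode (set_code (content_init T i), i))"

definition total_seq :: "(nat \<Rightarrow> nat option) \<Rightarrow> bool" where
  "total_seq p \<longleftrightarrow> (\<forall>i. p i \<noteq> None)"

definition Ex :: "(nat \<Rightarrow> nat \<Rightarrow> nat option) \<Rightarrow> (nat \<Rightarrow> nat) \<Rightarrow> textseq \<Rightarrow> bool" where
  "Ex \<phi> p T \<longleftrightarrow> (\<exists>n0. \<forall>n\<ge>n0. p n = p n0 \<and> W \<phi> (p n0) = content T)"

definition Wb :: "(nat \<Rightarrow> nat \<Rightarrow> nat option) \<Rightarrow> (nat \<Rightarrow> nat) \<Rightarrow> textseq \<Rightarrow> bool" where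
  "Wb \<phi> p T \<longleftrightarrow> (\<forall>n m. (\<exists>k. n \<le> k \<and> k \<le> m \<and> p n \<noteq> p k) \<longrightarrow>
       (content_init T m \<inter> W \<phi> (p m)) - W \<phi> (p n) \<noteq> {})"

definition CautTar :: "(nat \<Rightarrow> nat \<Rightarrow> nat option) \<Rightarrow> (nat \<Rightarrow> nat) \<Rightarrow> textseq \<Rightarrow> bool" where
  "CautTar \<phi> p T \<longleftrightarrow> (\<forall>n. \<not> (content T \<subset> W \<phi> (p n)))"

definition TxtPsdEx_learns ::
  "(nat \<Rightarrow> nat \<Rightarrow> nat option) \<Rightarrow> ((nat \<Rightarrow> nat) \<Rightarrow> textseq \<Rightarrow> bool)
     \<Rightarrow> (nat \<Rightarrow> nat option) \<Rightarrow> nat set \<Rightarrow> bool" where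
  "TxtPsdEx_learns \<phi> \<delta> h L \<longleftrightarrow>
     (\<forall>T\<in>Txt L. total_seq (Psd h T) \<and> \<delta> (the \<circ> Psd h T) T \<and> Ex \<phi> (the \<circ> Psd h T) T)"

end

theory Submission
  imports Defs
begin

text \<open>A \<open>Wb\<close>-learner is target-cautious because its final hypothesis must contain a datum outside
  every earlier, different one. Conversely, let \<open>h\<close> be target-cautious. The new learner is total
  computable and \<open>Wb\<close> on every text. Its hypotheses are attached to
  nodes \<open>(C, j)\<close> asserting that the target meets \<open>{..<j}\<close> exactly in \<open>C\<close>: the set enumerates
  \<open>W\<^sub>e\<close> for \<open>e = h(C, 2j)\<close> as long as it adds nothing below \<open>j\<close> and no mind change of \<open>h\<close> is seen
  on data within the enumerated elements. This makes failure of inclusion of the data in a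
  hypothesis decidable at the stage where a mind change shows up, and a node is abandoned, along
  the path \<open>D \<inter> {..<0}, D \<inter> {..<1}, \<dots>\<close>, only then. Caution of \<open>h\<close> prevents the learner from
  being stuck in a proper superset of the target, and locking sequences of \<open>h\<close> make all late
  nodes correct.\<close>


section \<open>Computable functions and decidable predicates\<close>

definition computable :: "(nat \<Rightarrow> nat) \<Rightarrow> bool" where
  "computable f \<longleftrightarrow> (\<lambda>x. Some (f x)) \<in> partrec"

definition decidable :: "(nat \<Rightarrow> bool) \<Rightarrow> bool" where
  "decidable P \<longleftrightarrow> computable (\<lambda>x. of_bool (P x))"

abbreviation p1 :: "nat \<Rightarrow> nat" where "p1 z \<equiv> fst (prod_decode z)"
abbreviation p2 :: "nat \<Rightarrow> nat" where "p2 z \<equiv> snd (prod_decode z)"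

named_theorems computable_intros

lemma computable_pair [computable_intros]:
  "computable f \<Longrightarrow> computable g \<Longrightarrow> computable (\<lambda>x. prod_encode (f x, g x))"
  using partrec.pair[of "\<lambda>x. Some (f x)" "\<lambda>x. Some (g x)"] by (simp add: computable_def)

lemma computable_comp:
  "computable f \<Longrightarrow> computable g \<Longrightarrow> computable (\<lambda>x. f (g x))"
  using partrec.comp[of "\<lambda>x. Some (f x)" "\<lambda>x. Some (g x)"] by (simp add: computable_def pcomp_def)

lemma computable_comp2:
  assumes "computable (\<lambda>z. F (p1 z) (p2 z))" "computable f" "computable g"
  shows "computable (\<lambda>x. F (f x) (g x))"
  using computable_comp[OF assms(1) computable_pair[OF assms(2,3)]] by simp

lemma computable_fst [computable_intros]: "computable f \<Longrightarrow> computable (\<lambda>x. p1 (f x))"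
  by (rule computable_comp) (simp_all add: computable_def partrec.left)

lemma computable_snd [computable_intros]: "computable f \<Longrightarrow> computable (\<lambda>x. p2 (f x))"
  by (rule computable_comp) (simp_all add: computable_def partrec.right)

lemma computable_id [computable_intros]: "computable (\<lambda>x. x)"
  using partrec.pair[OF partrec.left partrec.right] by (simp add: computable_def)

lemma computable_Suc [computable_intros]: "computable f \<Longrightarrow> computable (\<lambda>x. Suc (f x))"
  by (rule computable_comp) (simp_all add: computable_def partrec.succ)

lemma computable_const [computable_intros]: "computable (\<lambda>x. c)"
proof (induction c)
  case 0
  show ?case using partrec.zero by (simp add: computable_def)
next
  case (Suc c)
  then show ?case by (rule computable_Suc)
qed

lemma computable_rec_nat:
  assumes "computable f" "computable b"
    and "computable (\<lambda>z. g (p1 z) (p1 (p2 z)) (p2 (p2 z)))"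
  shows "computable (\<lambda>x. rec_nat (f x) (\<lambda>n r. g x n r) (b x))"
proof -
  let ?f = "\<lambda>x. Some (f x)" and ?g = "\<lambda>z. Some (g (p1 z) (p1 (p2 z)) (p2 (p2 z)))"
  have aux: "prec_aux ?f ?g a n = Some (rec_nat (f a) (\<lambda>n r. g a n r) n)" for a n
    by (induction n) auto
  have "computable (\<lambda>z. rec_nat (f (p1 z)) (\<lambda>n r. g (p1 z) n r) (p2 z))"
    using partrec.prec[of ?f ?g] assms by (simp add: computable_def aux)
  from computable_comp2[OF this computable_id assms(2)] show ?thesis .
qed


lemma computable_add [computable_intros]:
  assumes "computable f" "computable g"
  shows "computable (\<lambda>x. f x + g x)"
proof -
  have "rec_nat m (\<lambda>_ r. Suc r) n = m + n" for m n by (induction n) auto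
  moreover have "computable (\<lambda>x. rec_nat (f x) (\<lambda>_ r. Suc r) (g x))"
    using assms by (intro computable_rec_nat computable_intros)
  ultimately show ?thesis by simp
qed

lemma computable_pred [computable_intros]:
  assumes "computable f"
  shows "computable (\<lambda>x. f x - 1)"
proof -
  have "rec_nat 0 (\<lambda>n r. n) m = m - 1" for m by (induction m) auto
  moreover have "computable (\<lambda>x. rec_nat 0 (\<lambda>n r. n) (f x))"
    using assms by (intro computable_rec_nat computable_intros)
  ultimately show ?thesis by simp
qed

lemma computable_diff [computable_intros]:
  assumes "computable f" "computable g"
  shows "computable (\<lambda>x. f x - g x)"
proof -
  have "rec_nat m (\<lambda>_ r. r - 1) n = m - n" for m n by (induction n) auto
  moreover have "computable (\<lambda>x. rec_nat (f x) (\<lambda>_ r. r - 1) (g x))"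
    using assms by (intro computable_rec_nat computable_intros)
  ultimately show ?thesis by simp
qed

lemma computable_mult [computable_intros]:
  assumes "computable f" "computable g"
  shows "computable (\<lambda>x. f x * g x)"
proof -
  have "rec_nat 0 (\<lambda>_ r. r + m) n = m * n" for m n by (induction n) auto
  moreover have "computable (\<lambda>x. rec_nat 0 (\<lambda>_ r. r + f x) (g x))"
    by (intro computable_rec_nat computable_intros assms computable_comp[OF assms(1)])
  ultimately show ?thesis by simp
qed

lemma computable_power [computable_intros]:
  assumes "computable f" "computable g"
  shows "computable (\<lambda>x. f x ^ g x)"
proof -
  have "rec_nat 1 (\<lambda>_ r. m * r) n = m ^ n" for m n :: nat by (induction n) auto
  moreover have "computable (\<lambda>x. rec_nat 1 (\<lambda>_ r. f x * r) (g x))"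
    by (intro computable_rec_nat computable_intros assms computable_comp[OF assms(1)])
  ultimately show ?thesis by simp
qed

lemma computable_of_bool [computable_intros]: "decidable P \<Longrightarrow> computable (\<lambda>x. of_bool (P x))"
  by (simp add: decidable_def)

lemma decidable_comp: "decidable P \<Longrightarrow> computable g \<Longrightarrow> decidable (\<lambda>x. P (g x))"
  unfolding decidable_def by (rule computable_comp)

lemma decidable_comp2:
  assumes "decidable (\<lambda>z. P (p1 z) (p2 z))" "computable f" "computable g"
  shows "decidable (\<lambda>x. P (f x) (g x))"
  using decidable_comp[OF assms(1) computable_pair[OF assms(2,3)]] by simp

lemma decidable_const [computable_intros]: "decidable (\<lambda>x. c)"
  by (simp add: decidable_def computable_const)

lemma decidable_not [computable_intros]:
  assumes "decidable P" shows "decidable (\<lambda>x. \<not> P x)"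
proof -
  have "computable (\<lambda>x. 1 - of_bool (P x))" by (intro computable_intros assms)
  moreover have "1 - of_bool (P x) = (of_bool (\<not> P x) :: nat)" for x by simp
  ultimately show ?thesis by (simp only: decidable_def)
qed

lemma decidable_conj [computable_intros]:
  assumes "decidable P" "decidable Q" shows "decidable (\<lambda>x. P x \<and> Q x)"
proof -
  have "computable (\<lambda>x. of_bool (P x) * of_bool (Q x))" by (intro computable_intros assms)
  then show ?thesis by (simp add: decidable_def of_bool_conj)
qed

lemma decidable_imp [computable_intros]:
  assumes "decidable P" "decidable Q" shows "decidable (\<lambda>x. P x \<longrightarrow> Q x)"
proof -
  have "decidable (\<lambda>x. \<not> (P x \<and> \<not> Q x))" by (intro computable_intros assms)
  then show ?thesis by simp
qed

lemma decidable_disj [computable_intros]: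
  assumes "decidable P" "decidable Q" shows "decidable (\<lambda>x. P x \<or> Q x)"
proof -
  have "decidable (\<lambda>x. \<not> P x \<longrightarrow> Q x)" by (intro computable_intros assms)
  then show ?thesis by (simp add: disj_imp)
qed

lemma computable_If [computable_intros]:
  assumes "decidable P" "computable f" "computable g"
  shows "computable (\<lambda>x. if P x then f x else g x)"
proof -
  have "computable (\<lambda>x. of_bool (P x) * f x + of_bool (\<not> P x) * g x)"
    by (intro computable_intros assms)
  moreover have "of_bool (P x) * f x + of_bool (\<not> P x) * g x = (if P x then f x else g x)" for x
    by simp
  ultimately show ?thesis by simp
qed

lemma decidable_le [computable_intros]:
  assumes "computable f" "computable g"
  shows "decidable (\<lambda>x. f x \<le> g x)"
proof -
  have "computable (\<lambda>x. 1 - (f x - g x))" by (intro computable_intros assms)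
  moreover have "1 - (f x - g x) = of_bool (f x \<le> g x)" for x by simp
  ultimately show ?thesis by (simp add: decidable_def)
qed

lemma decidable_less [computable_intros]:
  assumes "computable f" "computable g"
  shows "decidable (\<lambda>x. f x < g x)"
  using decidable_le[OF computable_Suc[OF assms(1)] assms(2)] by (simp add: Suc_le_eq)

lemma decidable_eq [computable_intros]:
  assumes "computable f" "computable g"
  shows "decidable (\<lambda>x. f x = g x)"
proof -
  have "decidable (\<lambda>x. f x \<le> g x \<and> g x \<le> f x)" by (intro computable_intros assms)
  then show ?thesis by (simp add: eq_iff)
qed

lemma decidable_all_less [computable_intros]:
  assumes "computable b" "decidable (\<lambda>z. P (p1 z) (p2 z))"
  shows "decidable (\<lambda>x. \<forall>n<b x. P x n)"
proof -
  have "rec_nat 1 (\<lambda>n r. if P x n then r else 0) m = (of_bool (\<forall>n<m. P x n) :: nat)" for x m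
    by (induction m) (auto simp: less_Suc_eq)
  moreover have "computable (\<lambda>x. rec_nat 1 (\<lambda>n r. if P x n then r else 0) (b x))"
    by (intro computable_rec_nat computable_intros assms decidable_comp2[OF assms(2)])
  ultimately show ?thesis by (simp only: decidable_def)
qed

lemma computable_mod [computable_intros]:
  assumes "computable f" "computable g"
  shows "computable (\<lambda>x. f x mod g x)"
proof -
  \<comment> \<open>The counter never wraps for \<open>m = 0\<close>, in agreement with
    \<open>n mod 0 = n\<close>.\<close>
  have "rec_nat 0 (\<lambda>_ r. if Suc r = m then 0 else Suc r) n = n mod m" for m n
    by (induction n) (auto simp: mod_Suc)
  moreover have "computable (\<lambda>x. rec_nat 0 (\<lambda>_ r. if Suc r = g x then 0 else Suc r) (f x))"
    by (intro computable_rec_nat computable_intros assms computable_comp[OF assms(2)])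
  ultimately show ?thesis by simp
qed

lemma decidable_mem [computable_intros]:
  assumes "computable f" "computable g"
  shows "decidable (\<lambda>x. f x \<in> set_decode (g x))"
proof -
  have "m \<in> set_decode n \<longleftrightarrow> 2 ^ m \<le> n mod 2 ^ Suc m" for m n
  proof -
    have "n mod 2 ^ Suc m = 2 ^ m * (n div 2 ^ m mod 2) + n mod 2 ^ m"
      by (metis mod_mult2_eq power_Suc2)
    moreover have "n mod 2 ^ m < 2 ^ m" by simp
    ultimately show ?thesis
      by (cases "even (n div 2 ^ m)")
        (simp_all del: power_Suc add: set_decode_def even_iff_mod_2_eq_zero odd_iff_mod_2_eq_one not_le)
  qed
  moreover have "decidable (\<lambda>x. 2 ^ f x \<le> g x mod 2 ^ Suc (f x))"
    by (intro computable_intros assms)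
  ultimately show ?thesis by simp
qed

text \<open>Unbounded search for a witness; through it the sets \<open>hyp C j\<close> become
  domains of partial computable functions.\<close>

lemma partrec_search:
  assumes "decidable (\<lambda>z. P (p1 z) (p2 z))"
  obtains f where "f \<in> partrec" "\<And>x. f x \<noteq> None \<longleftrightarrow> (\<exists>n. P x n)"
proof
  let ?g = "\<lambda>z. Some (of_bool (\<not> P (p1 z) (p2 z))) :: nat option"
  have "computable (\<lambda>z. of_bool (\<not> P (p1 z) (p2 z)))" by (intro computable_intros assms)
  then show "rfind ?g \<in> partrec" by (intro partrec.rfind) (simp add: computable_def)
  show "rfind ?g x \<noteq> None \<longleftrightarrow> (\<exists>n. P x n)" for x
  proof -
    have "(\<exists>n. P x n) \<longleftrightarrow> (\<exists>n. P x n \<and> (\<forall>m<n. \<not> P x m))"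
      using exists_least_iff by blast
    then show ?thesis by (auto simp: rfind_def)
  qed
qed

section \<open>Step-bounded approximation of partial computable functions\<close>

text \<open>\<open>A x t\<close> is \<open>0\<close> while the computation on \<open>x\<close> has not halted within \<open>t\<close> steps, and the
  successor of its value afterwards.\<close>

definition approximates :: "(nat \<Rightarrow> nat \<Rightarrow> nat) \<Rightarrow> (nat \<Rightarrow> nat option) \<Rightarrow> bool" where
  "approximates A f \<longleftrightarrow> (\<forall>x t u. A x t \<noteq> 0 \<longrightarrow> t \<le> u \<longrightarrow> A x u = A x t) \<and>
     (\<forall>x y. f x = Some y \<longleftrightarrow> (\<exists>t. A x t = Suc y))"

lemma approximates_stable: "approximates A f \<Longrightarrow> A x t \<noteq> 0 \<Longrightarrow> t \<le> u \<Longrightarrow> A x u = A x t"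
  unfolding approximates_def by blast

lemma approximates_iff: "approximates A f \<Longrightarrow> f x = Some y \<longleftrightarrow> (\<exists>t. A x t = Suc y)"
  unfolding approximates_def by blast

lemma approximates_eventually:
  assumes "approximates A f" "f x = Some y"
  shows "\<exists>t0. \<forall>t\<ge>t0. A x t = Suc y"
proof -
  obtain t0 where t0: "A x t0 = Suc y" using assms approximates_iff by blast
  then have "\<forall>t\<ge>t0. A x t = Suc y" using approximates_stable[OF assms(1), of x t0] by simp
  then show ?thesis ..
qed

lemma approximates_computable:
  assumes "computable f"
  shows "\<exists>A. computable (\<lambda>z. A (p1 z) (p2 z)) \<and> approximates A (\<lambda>x. Some (f x))"
proof (intro exI conjI)
  show "computable (\<lambda>z. Suc (f (p1 z)))" by (intro computable_intros computable_comp[OF assms])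
  show "approximates (\<lambda>x t. Suc (f x)) (\<lambda>x. Some (f x))" by (simp add: approximates_def)
qed

lemma approximates_pair:
  assumes A: "approximates A f" and B: "approximates B g"
  shows "approximates (\<lambda>x t. if A x t = 0 \<or> B x t = 0 then 0
            else Suc (prod_encode (A x t - 1, B x t - 1)))
     (\<lambda>x. Option.bind (f x) (\<lambda>a. Option.bind (g x) (\<lambda>b. Some (prod_encode (a, b)))))"
    (is "approximates ?C ?h")
  unfolding approximates_def
proof (intro conjI allI impI)
  show "?C x u = ?C x t" if "?C x t \<noteq> 0" "t \<le> u" for x t u
    using that approximates_stable[OF A, of x t u] approximates_stable[OF B, of x t u]
    by (auto split: if_splits)
  show "?h x = Some y \<longleftrightarrow> (\<exists>t. ?C x t = Suc y)" for x y
  proof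
    assume "?h x = Some y"
    then obtain a b where ab: "f x = Some a" "g x = Some b" "y = prod_encode (a, b)"
      by (auto simp: bind_eq_Some_conv)
    then obtain t u where "A x t = Suc a" "B x u = Suc b"
      using A B by (auto simp: approximates_iff)
    then have "A x (max t u) = Suc a" "B x (max t u) = Suc b"
      using approximates_stable[OF A, of x t "max t u"] approximates_stable[OF B, of x u "max t u"]
      by auto
    then show "\<exists>t. ?C x t = Suc y" using ab by (intro exI[of _ "max t u"]) simp
  next
    assume "\<exists>t. ?C x t = Suc y"
    then obtain t where t: "?C x t = Suc y" ..
    then obtain a b where "A x t = Suc a" "B x t = Suc b" "y = prod_encode (a, b)"
      by (cases "A x t"; cases "B x t") auto
    moreover from this have "f x = Some a" "g x = Some b"
      using A B approximates_iff by blast+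
    ultimately show "?h x = Some y" by simp
  qed
qed

lemma approximates_comp:
  assumes A: "approximates A f" and B: "approximates B g"
  shows "approximates (\<lambda>x t. if B x t = 0 then 0 else A (B x t - 1) t) (pcomp f g)"
    (is "approximates ?C ?h")
  unfolding approximates_def
proof (intro conjI allI impI)
  show "?C x u = ?C x t" if "?C x t \<noteq> 0" "t \<le> u" for x t u
    using that approximates_stable[OF A, of "B x t - 1" t u] approximates_stable[OF B, of x t u]
    by (auto split: if_splits)
  show "?h x = Some y \<longleftrightarrow> (\<exists>t. ?C x t = Suc y)" for x y
  proof
    assume "?h x = Some y"
    then obtain a where a: "g x = Some a" "f a = Some y"
      by (auto simp: pcomp_def bind_eq_Some_conv)
    then obtain t u where "A a t = Suc y" "B x u = Suc a"
      using A B by (auto simp: approximates_iff)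
    then have "A a (max t u) = Suc y" "B x (max t u) = Suc a"
      using approximates_stable[OF A, of a t "max t u"] approximates_stable[OF B, of x u "max t u"]
      by auto
    then show "\<exists>t. ?C x t = Suc y" by (intro exI[of _ "max t u"]) simp
  next
    assume "\<exists>t. ?C x t = Suc y"
    then obtain t where t: "?C x t = Suc y" ..
    then obtain a where "B x t = Suc a" "A a t = Suc y" by (cases "B x t") auto
    then have "g x = Some a" "f a = Some y" using A B approximates_iff by blast+
    then show "?h x = Some y" by (simp add: pcomp_def)
  qed
qed

text \<open>One step bound \<open>t\<close> serves all levels of the recursion, and the
  \<open>0\<close> of an unfinished level propagates upward. Values are stored as successors, whence
  \<open>r - 1\<close>.\<close>

definition rec_approx :: "(nat \<Rightarrow> nat \<Rightarrow> nat) \<Rightarrow> (nat \<Rightarrow> nat \<Rightarrow> nat) \<Rightarrow> nat \<Rightarrow> nat \<Rightarrow> nat \<Rightarrow> nat" where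
  "rec_approx A B a t n = rec_nat (A a t)
     (\<lambda>n r. if r = 0 then 0 else B (prod_encode (a, prod_encode (n, r - 1))) t) n"

lemma approximates_prec_aux:
  assumes A: "approximates A f" and B: "approximates B g"
  shows "approximates (\<lambda>n t. rec_approx A B a t n) (prec_aux f g a)"
proof -
  have stable: "rec_approx A B a u n = rec_approx A B a t n"
    if "rec_approx A B a t n \<noteq> 0" "t \<le> u" for n t u
    using that(1)
  proof (induction n)
    case 0
    then show ?case using approximates_stable[OF A _ that(2)] by (simp add: rec_approx_def)
  next
    case (Suc n)
    let ?z = "prod_encode (a, prod_encode (n, rec_approx A B a t n - 1))"
    have nz: "rec_approx A B a t n \<noteq> 0" and eq: "rec_approx A B a t (Suc n) = B ?z t"
      using Suc.prems by (auto simp: rec_approx_def split: if_splits)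
    have "rec_approx A B a u (Suc n) = B ?z u"
      using Suc.IH[OF nz] nz by (simp add: rec_approx_def)
    also have "\<dots> = B ?z t" using Suc.prems eq approximates_stable[OF B _ that(2)] by simp
    finally show ?case using eq by simp
  qed
  have "prec_aux f g a n = Some y \<longleftrightarrow> (\<exists>t. rec_approx A B a t n = Suc y)" for n y
  proof (induction n arbitrary: y)
    case 0
    then show ?case using A by (simp add: rec_approx_def approximates_iff)
  next
    case (Suc n)
    show ?case
    proof
      assume "prec_aux f g a (Suc n) = Some y"
      then obtain r where r: "prec_aux f g a n = Some r"
        "g (prod_encode (a, prod_encode (n, r))) = Some y"
        by (auto simp: bind_eq_Some_conv)
      then obtain t u where tu: "rec_approx A B a t n = Suc r"
        "B (prod_encode (a, prod_encode (n, r))) u = Suc y"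
        using Suc.IH B by (auto simp: approximates_iff)
      have "rec_approx A B a (max t u) n = Suc r"
        "B (prod_encode (a, prod_encode (n, r))) (max t u) = Suc y"
        using stable[of t n "max t u"] tu approximates_stable[OF B, of _ u "max t u"] by auto
      then show "\<exists>t. rec_approx A B a t (Suc n) = Suc y"
        by (intro exI[of _ "max t u"]) (simp add: rec_approx_def)
    next
      assume "\<exists>t. rec_approx A B a t (Suc n) = Suc y"
      then obtain t where t: "rec_approx A B a t (Suc n) = Suc y" ..
      then obtain r where r: "rec_approx A B a t n = Suc r"
        by (cases "rec_approx A B a t n") (auto simp: rec_approx_def)
      with t have "B (prod_encode (a, prod_encode (n, r))) t = Suc y"
        by (simp add: rec_approx_def)
      then have "g (prod_encode (a, prod_encode (n, r))) = Some y"
        using B approximates_iff by blast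
      moreover have "prec_aux f g a n = Some r" using r Suc.IH by blast
      ultimately show "prec_aux f g a (Suc n) = Some y" by simp
    qed
  qed
  with stable show ?thesis unfolding approximates_def by blast
qed

lemma rec_nat_search:
  "rec_nat 0 (\<lambda>_ r. if Q r then r else Suc r) t = n \<longleftrightarrow> (\<forall>m<n. \<not> Q m) \<and> (n = t \<or> n < t \<and> Q n)"
proof (induction t arbitrary: n)
  case (Suc t)
  define r where "r = rec_nat 0 (\<lambda>_ r. if Q r then r else Suc r) t"
  have r: "\<forall>m<r. \<not> Q m" "r = t \<or> r < t \<and> Q r" using Suc[of r] by (auto simp: r_def)
  have step: "rec_nat 0 (\<lambda>_ r. if Q r then r else Suc r) (Suc t) = (if Q r then r else Suc r)"
    by (simp add: r_def)
  show ?case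
  proof (cases "Q r")
    case True
    have "r = n \<longleftrightarrow> (\<forall>m<n. \<not> Q m) \<and> (n = Suc t \<or> n < Suc t \<and> Q n)"
      using r True by (metis less_SucI less_Suc_eq linorder_neqE_nat)
    with True show ?thesis unfolding step by simp
  next
    case False
    with r have "r = t" by blast
    with False r have "Suc r = n \<longleftrightarrow> (\<forall>m<n. \<not> Q m) \<and> (n = Suc t \<or> n < Suc t \<and> Q n)"
      by (metis less_Suc_eq)
    with False show ?thesis unfolding step by simp
  qed
qed auto

text \<open>Within \<open>t\<close> rounds the search halts at the first \<open>r\<close> whose
  approximation is at most \<open>1\<close>, so whose value is \<open>0\<close> or still unknown.
  Only the former yields a result: an unfinished computation is never skipped, and results do not
  change at later stages.\<close>

definition search_approx :: "(nat \<Rightarrow> nat \<Rightarrow> nat) \<Rightarrow> nat \<Rightarrow> nat \<Rightarrow> nat" where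
  "search_approx A a t =
     (let n = rec_nat 0 (\<lambda>_ r. if A (prod_encode (a, r)) t \<le> 1 then r else Suc r) t
      in if A (prod_encode (a, n)) t = 1 then Suc n else 0)"

lemma search_approx_eq_Suc:
  "search_approx A a t = Suc n \<longleftrightarrow> n \<le> t \<and> A (prod_encode (a, n)) t = 1 \<and>
     (\<forall>m<n. 1 < A (prod_encode (a, m)) t)"
proof -
  define Q where "Q = (\<lambda>r. A (prod_encode (a, r)) t \<le> 1)"
  define r where "r = rec_nat 0 (\<lambda>_ r. if Q r then r else Suc r) t"
  have r: "r = m \<longleftrightarrow> (\<forall>k<m. \<not> Q k) \<and> (m = t \<or> m < t \<and> Q m)" for m
    unfolding r_def by (rule rec_nat_search)
  have eq: "search_approx A a t = (if A (prod_encode (a, r)) t = 1 then Suc r else 0)"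
    by (simp add: search_approx_def r_def Q_def)
  show ?thesis
  proof
    assume "search_approx A a t = Suc n"
    with eq have "r = n" "A (prod_encode (a, n)) t = 1" by (auto split: if_splits)
    with r[of n] show "n \<le> t \<and> A (prod_encode (a, n)) t = 1 \<and> (\<forall>m<n. 1 < A (prod_encode (a, m)) t)"
      by (auto simp: Q_def not_le)
  next
    assume n: "n \<le> t \<and> A (prod_encode (a, n)) t = 1 \<and> (\<forall>m<n. 1 < A (prod_encode (a, m)) t)"
    then have "(\<forall>k<n. \<not> Q k) \<and> (n = t \<or> n < t \<and> Q n)" by (auto simp: Q_def)
    with r[of n] have "r = n" by blast
    with eq n show "search_approx A a t = Suc n" by simp
  qed
qed

lemma approximates_rfind:
  assumes A: "approximates A f"
  shows "approximates (search_approx A) (rfind f)"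
  unfolding approximates_def
proof (intro conjI allI impI)
  show "search_approx A a u = search_approx A a t" if nz: "search_approx A a t \<noteq> 0" and le: "t \<le> u"
    for a t u
  proof -
    obtain n where n: "search_approx A a t = Suc n" using nz not0_implies_Suc by blast
    have stable: "A x u = A x t" if "0 < A x t" for x
      using approximates_stable[OF A] that le by blast
    have "search_approx A a u = Suc n"
      using n le stable unfolding search_approx_eq_Suc by fastforce
    with n show ?thesis by simp
  qed
  show "rfind f a = Some n \<longleftrightarrow> (\<exists>t. search_approx A a t = Suc n)" for a n
  proof -
    let ?P = "\<lambda>n. f (prod_encode (a, n)) = Some 0 \<and>
        (\<forall>m<n. \<exists>k. f (prod_encode (a, m)) = Some (Suc k))"
    have unique: "m = n" if "?P m" "?P n" for m n
      using that by (metis linorder_neqE_nat nat.distinct(1) option.inject)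
    have "rfind f a = Some n \<longleftrightarrow> ?P n"
    proof
      assume "rfind f a = Some n"
      then have ex: "\<exists>n. ?P n" and n: "n = (LEAST n. ?P n)"
        by (auto simp: rfind_def split: if_splits)
      show "?P n" unfolding n by (rule LeastI_ex[OF ex])
    next
      assume P: "?P n"
      have "(LEAST n. ?P n) = n" using unique LeastI[of ?P, OF P] P by blast
      with P show "rfind f a = Some n" unfolding rfind_def by (metis (mono_tags, lifting))
    qed
    also have "\<dots> \<longleftrightarrow> (\<exists>t. search_approx A a t = Suc n)"
    proof
      assume P: "?P n"
      have "\<exists>t0. \<forall>t\<ge>t0. (m < n \<longrightarrow> 1 < A (prod_encode (a, m)) t) \<and>
               (m = n \<longrightarrow> A (prod_encode (a, m)) t = 1)" for m
      proof (cases m n rule: linorder_cases)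
        case less
        then obtain k where "f (prod_encode (a, m)) = Some (Suc k)" using P by blast
        from approximates_eventually[OF A this] less show ?thesis by fastforce
      next
        case equal
        with approximates_eventually[OF A, of "prod_encode (a, n)" 0] P show ?thesis by auto
      qed auto
      then obtain t0 where t0: "\<And>m t. t \<ge> t0 m \<Longrightarrow> (m < n \<longrightarrow> 1 < A (prod_encode (a, m)) t) \<and>
               (m = n \<longrightarrow> A (prod_encode (a, m)) t = 1)" by metis
      \<comment> \<open>Each argument up to \<open>n\<close> settles at a stage of its own. The
        maximum also includes \<open>n\<close>, since the search makes only \<open>t\<close>
        rounds.\<close>
      define t where "t = Max (insert n (t0 ` {..n}))"
      have "n \<le> t" "\<And>m. m \<le> n \<Longrightarrow> t0 m \<le> t"
        unfolding t_def by (rule Max_ge; simp)+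
      then have "search_approx A a t = Suc n"
        using t0[of _ t] by (simp add: search_approx_eq_Suc) (metis less_imp_le_nat order_refl)
      then show "\<exists>t. search_approx A a t = Suc n" ..
    next
      assume "\<exists>t. search_approx A a t = Suc n"
      then obtain t where t: "A (prod_encode (a, n)) t = Suc 0"
        "\<And>m. m < n \<Longrightarrow> 1 < A (prod_encode (a, m)) t" by (auto simp: search_approx_eq_Suc)
      have "\<exists>k. f (prod_encode (a, m)) = Some (Suc k)" if "m < n" for m
      proof -
        have "A (prod_encode (a, m)) t = Suc (Suc (A (prod_encode (a, m)) t - 2))"
          using t(2)[OF that] by simp
        then show ?thesis using approximates_iff[OF A] by blast
      qed
      moreover have "f (prod_encode (a, n)) = Some 0" using t(1) approximates_iff[OF A] by blast
      ultimately show "?P n" by blast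
    qed
    finally show ?thesis .
  qed
qed

text \<open>Stages of computation are obtained along the inductive generation of
  \<open>partrec\<close>, without coding machines or programs.\<close>

theorem partrec_approximation:
  assumes "f \<in> partrec"
  shows "\<exists>A. computable (\<lambda>z. A (p1 z) (p2 z)) \<and> approximates A f"
  using assms
proof induction
  case (pair f g)
  then obtain A B where AB: "computable (\<lambda>z. A (p1 z) (p2 z))" "approximates A f"
    "computable (\<lambda>z. B (p1 z) (p2 z))" "approximates B g" by blast
  show ?case
    by (rule exI, rule conjI[rotated], rule approximates_pair[OF AB(2,4)]) (intro computable_intros AB)
next
  case (comp f g)
  then obtain A B where AB: "computable (\<lambda>z. A (p1 z) (p2 z))" "approximates A f"
    "computable (\<lambda>z. B (p1 z) (p2 z))" "approximates B g" by blast
  show ?case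
    by (rule exI, rule conjI[rotated], rule approximates_comp[OF AB(2,4)])
      (intro computable_intros AB computable_comp2[OF AB(1)])
next
  case (prec f g)
  then obtain A B where AB: "computable (\<lambda>z. A (p1 z) (p2 z))" "approximates A f"
    "computable (\<lambda>z. B (p1 z) (p2 z))" "approximates B g" by blast
  let ?C = "\<lambda>x t. rec_approx A B (p1 x) t (p2 x)"
  have "approximates ?C (\<lambda>x. prec_aux f g (p1 x) (p2 x))"
    using approximates_prec_aux[OF AB(2,4)] unfolding approximates_def by blast
  moreover have "computable (\<lambda>z. ?C (p1 z) (p2 z))"
    unfolding rec_approx_def
    by (intro computable_rec_nat computable_intros computable_comp2[OF AB(1)]
        computable_comp2[OF AB(3)])
  ultimately show ?case by (intro exI[of _ ?C] conjI)
next
  case (rfind f)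
  then obtain A where A: "computable (\<lambda>z. A (p1 z) (p2 z))" "approximates A f" by blast
  have "computable (\<lambda>z. search_approx A (p1 z) (p2 z))"
    unfolding search_approx_def Let_def
    by (intro computable_intros computable_comp2[OF A(1)] computable_rec_nat)
  then show ?case by (intro exI[of _ "search_approx A"] conjI approximates_rfind A(2))
next
  case zero
  show ?case by (rule approximates_computable[OF computable_const])
next
  case succ
  show ?case by (rule approximates_computable[OF computable_Suc[OF computable_id]])
next
  case left
  show ?case by (rule approximates_computable[OF computable_fst[OF computable_id]])
next
  case right
  show ?case by (rule approximates_computable[OF computable_snd[OF computable_id]])
qed


section \<open>The witness-based learner\<close>

lemma bounded_mono_eventually_const:
  fixes f :: "nat \<Rightarrow> nat"
  assumes "mono f" "\<And>n. f n \<le> b"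
  shows "\<exists>n0. \<forall>n\<ge>n0. f n = f n0"
proof -
  have fin: "finite (range f)" using assms(2) by (auto intro: finite_subset[of _ "{..b}"])
  then obtain n0 where n0: "f n0 = Max (range f)" using Max_in[OF fin] by fastforce
  have "f n = f n0" if "n0 \<le> n" for n
    using monoD[OF assms(1) that] Max_ge[OF fin, of "f n"] n0 by simp
  then show ?thesis by blast
qed

text \<open>\<open>a D j t\<close> approximates the hypothesis \<open>h D (2 * j)\<close> of the given learner on data \<open>D\<close>, and
  \<open>u e x t\<close> says that \<open>x\<close> has been enumerated into the \<open>e\<close>-th set within \<open>t\<close> steps. A node is a
  pair \<open>(C, j)\<close> with \<open>C \<subseteq> {..<j}\<close>, claiming that the target meets \<open>{..<j}\<close> exactly in \<open>C\<close>.\<close>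

locale approximated_learner =
  fixes a :: "nat set \<Rightarrow> nat \<Rightarrow> nat \<Rightarrow> nat" and u :: "nat \<Rightarrow> nat \<Rightarrow> nat \<Rightarrow> bool"
  assumes a_stable: "a D j t \<noteq> 0 \<Longrightarrow> t \<le> t' \<Longrightarrow> a D j t' = a D j t"
    and u_mono: "u e x t \<Longrightarrow> t \<le> t' \<Longrightarrow> u e x t'"
begin

definition enum :: "nat \<Rightarrow> nat set" where
  "enum e = {x. \<exists>t. u e x t}"

definition cand :: "nat set \<Rightarrow> nat \<Rightarrow> nat \<Rightarrow> nat set" where
  "cand C j t = {x. x \<in> C \<or> a C j t \<noteq> 0 \<and> u (a C j t - 1) x t}"

text \<open>No mind change of the given learner has been seen on data between \<open>C\<close> and
  \<open>D \<union> cand C j t\<close>.\<close>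

definition stable :: "nat set \<Rightarrow> nat \<Rightarrow> nat set \<Rightarrow> nat \<Rightarrow> bool" where
  "stable C j D t \<longleftrightarrow> (D \<union> cand C j t) \<inter> {..<j} \<subseteq> C \<and>
     (\<forall>k\<le>t. j \<le> k \<longrightarrow> (\<forall>E\<subseteq>{..<k}. C \<subseteq> E \<and> E \<subseteq> D \<union> cand C j t \<longrightarrow>
        a E k t = 0 \<or> a C j t = 0 \<or> a E k t = a C j t))"

text \<open>Demanding that \<open>C\<close> be enumerated by the guessed set keeps
  \<open>hyp C j\<close> inside that set as soon as any stage is sound. In this way caution carries
  over.\<close>

definition sound :: "nat set \<Rightarrow> nat \<Rightarrow> nat \<Rightarrow> bool" where
  "sound C j t \<longleftrightarrow> a C j t \<noteq> 0 \<and> (\<forall>x\<in>C. u (a C j t - 1) x t) \<and> stable C j {} t"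

text \<open>The base \<open>C\<close> is included unconditionally: the datum that \<open>Wb\<close>
  asks for is taken from the base of the current node.\<close>

definition hyp :: "nat set \<Rightarrow> nat \<Rightarrow> nat set" where
  "hyp C j = {x. x \<in> C \<or> (\<exists>t. sound C j t \<and> x \<in> cand C j t)}"

text \<open>A decidable condition that, by stage \<open>k\<close>, guarantees that \<open>D\<close> is not contained in
  \<open>hyp C j\<close>.\<close>

definition refuted :: "nat set \<Rightarrow> nat \<Rightarrow> nat set \<Rightarrow> nat \<Rightarrow> bool" where
  "refuted C j D k \<longleftrightarrow>
     \<not> D \<subseteq> C \<and> (\<forall>t<k. sound C j t \<longrightarrow> \<not> D \<subseteq> cand C j t) \<and> \<not> stable C j D k"

text \<open>Conservative learning along the canonical path \<open>D \<inter> {..<0}, D \<inter> {..<1}, \<dots>\<close>.\<close>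

fun anchor :: "nat set \<Rightarrow> nat \<Rightarrow> nat" where
  "anchor D 0 = 0"
| "anchor D (Suc n) =
     (if refuted (D \<inter> {..<anchor D n}) (anchor D n) (D \<inter> {..<Suc n}) (Suc n)
      then Suc n else anchor D n)"

definition node :: "nat set \<Rightarrow> nat \<Rightarrow> nat set \<times> nat" where
  "node D i = (D \<inter> {..<anchor D i}, anchor D i)"

section \<open>Monotonicity of stability and refutation\<close>

lemma cand_mono: "t \<le> t' \<Longrightarrow> cand C j t \<subseteq> cand C j t'"
  using a_stable[of C j t t'] u_mono[of _ _ t t'] by (auto simp: cand_def)

lemma base_subset_cand: "C \<subseteq> cand C j t"
  by (auto simp: cand_def)

lemma base_subset_hyp: "C \<subseteq> hyp C j"
  by (auto simp: hyp_def)

text \<open>Fewer data and an earlier stage leave fewer sets \<open>E\<close> to compare, and a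
  value already present at \<open>t'\<close> is the same at \<open>t\<close>.\<close>

lemma stable_antimono:
  assumes "stable C j D t" "D' \<subseteq> D \<union> cand C j t" "t' \<le> t"
  shows "stable C j D' t'"
  unfolding stable_def
proof (intro conjI allI impI)
  have sub: "D' \<union> cand C j t' \<subseteq> D \<union> cand C j t" using assms(2) cand_mono[OF assms(3)] by blast
  then show "(D' \<union> cand C j t') \<inter> {..<j} \<subseteq> C" using assms(1) by (auto simp: stable_def)
  fix k E
  assume *: "k \<le> t'" "j \<le> k" "E \<subseteq> {..<k}" "C \<subseteq> E \<and> E \<subseteq> D' \<union> cand C j t'"
  then have "a E k t = 0 \<or> a C j t = 0 \<or> a E k t = a C j t"
    using assms(1,3) sub unfolding stable_def by (meson le_trans subset_trans)
  then show "a E k t' = 0 \<or> a C j t' = 0 \<or> a E k t' = a C j t'"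
    using a_stable[OF _ assms(3)] by metis
qed

lemma hyp_below: "hyp C j \<inter> {..<j} \<subseteq> C"
  by (auto simp: hyp_def sound_def stable_def)

text \<open>The sets \<open>cand C j t\<close> grow with \<open>t\<close>, so finitely many elements
  contributed at sound stages are all present at the latest of these stages.\<close>

lemma finite_subset_hyp:
  assumes "finite D" "D \<subseteq> hyp C j"
  shows "D \<subseteq> C \<or> (\<exists>t. sound C j t \<and> D \<subseteq> cand C j t)"
  using assms
proof (induction D rule: finite_induct)
  case (insert x D)
  show ?case
  proof (cases "x \<in> C")
    case True
    with insert show ?thesis by (auto simp: cand_def)
  next
    case False
    with insert.prems obtain t where t: "sound C j t" "x \<in> cand C j t" by (auto simp: hyp_def)
    consider "D \<subseteq> C" | t' where "sound C j t'" "D \<subseteq> cand C j t'" using insert by auto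
    then show ?thesis
    proof cases
      case 1
      with t base_subset_cand show ?thesis by blast
    next
      case 2
      with t cand_mono[of t t'] cand_mono[of t' t] show ?thesis
        by (cases "t \<le> t'") (meson insert_subset subset_iff nle_le)+
    qed
  qed
qed simp

text \<open>Otherwise \<open>D\<close> would lie in \<open>cand C j t\<close> for some sound
  \<open>t\<close>, necessarily with \<open>k \<le> t\<close>. Stability at \<open>t\<close> then
  covers the data \<open>D\<close> at the earlier stage \<open>k\<close>, where instability was
  observed.\<close>

lemma refuted_sound:
  assumes "finite D" "refuted C j D k"
  shows "\<not> D \<subseteq> hyp C j"
proof
  assume "D \<subseteq> hyp C j"
  with assms obtain t where t: "sound C j t" "D \<subseteq> cand C j t"
    using finite_subset_hyp unfolding refuted_def by blast
  with assms(2) have "k \<le> t" unfolding refuted_def by (meson not_le)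
  with t stable_antimono[of C j "{}" t D k] assms(2) show False
    by (auto simp: refuted_def sound_def)
qed

lemma refuted_mono: "refuted C j D k \<Longrightarrow> D \<subseteq> D' \<Longrightarrow> refuted C j D' k"
  unfolding refuted_def using stable_antimono[of C j D' k D k] by blast

section \<open>Movement of the anchor along the canonical path\<close>

lemma anchor_le: "anchor D n \<le> n"
  by (induction n) auto

lemma anchor_mono: "m \<le> n \<Longrightarrow> anchor D m \<le> anchor D n"
proof (induction n rule: dec_induct)
  case (step n)
  with anchor_le[of D n] show ?case by auto
qed simp

lemma anchor_cong: "D \<inter> {..<n} = E \<inter> {..<n} \<Longrightarrow> anchor D n = anchor E n"
proof (induction n)
  case (Suc n)
  have "D \<inter> {..<k} = E \<inter> {..<k}" if "k \<le> Suc n" for k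
    using Suc.prems that by fastforce
  then have "anchor D n = anchor E n" "D \<inter> {..<anchor D n} = E \<inter> {..<anchor D n}"
    using Suc.IH anchor_le[of D n] by auto
  with Suc.prems show ?case by simp
qed simp

text \<open>A nonzero anchor is the stage of the last abandonment, so nothing moves from there up to
  the current stage.\<close>

lemma anchor_between: "anchor D n \<le> m \<Longrightarrow> m \<le> n \<Longrightarrow> anchor D m = anchor D n"
proof (induction n)
  case (Suc n)
  show ?case
  proof (cases "m = Suc n")
    case False
    with Suc.prems have "m \<le> n" by simp
    with Suc show ?thesis by (auto split: if_splits)
  qed simp
qed simp

text \<open>The first change after \<open>m\<close> comes from a refutation of the node held at
  \<open>m\<close>. The bound \<open>k \<le> anchor D n\<close> puts the refuting data into the base
  of the node at stage \<open>n\<close>.\<close>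

lemma anchor_changed:
  assumes "m \<le> n" "anchor D n \<noteq> anchor D m"
  shows "\<exists>k. m < k \<and> k \<le> anchor D n \<and>
    refuted (D \<inter> {..<anchor D m}) (anchor D m) (D \<inter> {..<k}) k"
  using assms
proof (induction n rule: dec_induct)
  case (step n)
  show ?case
  proof (cases "anchor D n = anchor D m")
    case True
    with step show ?thesis by (intro exI[of _ "Suc n"]) (auto split: if_splits)
  next
    case False
    then obtain k where k: "m < k" "k \<le> anchor D n"
      "refuted (D \<inter> {..<anchor D m}) (anchor D m) (D \<inter> {..<k}) k" using step.IH by blast
    moreover have "anchor D n \<le> anchor D (Suc n)" by (rule anchor_mono) simp
    ultimately show ?thesis by (meson le_trans)
  qed
qed simp

lemma anchor_unchanged:
  assumes "anchor D n = anchor D m" "m < k" "k \<le> n"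
  shows "\<not> refuted (D \<inter> {..<anchor D m}) (anchor D m) (D \<inter> {..<k}) k"
proof -
  obtain l where l: "k = Suc l" using assms(2) by (cases k) auto
  have "anchor D l = anchor D m" "anchor D k = anchor D m"
    using assms l anchor_mono[of m l D] anchor_mono[of l n D] anchor_mono[of m k D]
      anchor_mono[of k n D] by auto
  then show ?thesis using l anchor_le[of D m] assms(2) by (auto split: if_splits)
qed

text \<open>At stage \<open>anchor D i\<close> the path of \<open>D\<close> has just reached this
  anchor, and up to there \<open>E\<close> is indistinguishable from \<open>D\<close>.\<close>

lemma anchor_agree:
  assumes "E \<inter> {..<anchor D i} = D \<inter> {..<anchor D i}"
  shows "anchor E (anchor D i) = anchor D i"
  using anchor_cong[OF assms] anchor_between[of D i "anchor D i"] anchor_le[of D i] by simp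

text \<open>If \<open>E\<close> contains a new element below the anchor of \<open>D\<close>, then the least such element lies below
  the anchor of \<open>E\<close>, because the refutations seen along \<open>D\<close> are also seen along \<open>E\<close>.\<close>

lemma anchor_above_new_element:
  assumes "D \<subseteq> E" "i \<le> k" "E \<inter> {..<anchor D i} \<noteq> D \<inter> {..<anchor D i}"
  shows "\<exists>x<anchor D i. x < anchor E k \<and> x \<in> E \<and> x \<notin> D"
proof -
  define x where "x = (LEAST x. x \<in> E \<and> x \<notin> D)"
  obtain y where y: "y \<in> E \<and> y \<notin> D" "y < anchor D i" using assms(1,3) by blast
  have xED: "x \<in> E \<and> x \<notin> D" and xy: "x \<le> y"
    unfolding x_def using y(1) by (rule LeastI, rule Least_le)
  have "z \<in> D" if "z \<in> E" "z < x" for z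
    using that(1) not_less_Least[OF that(2)[unfolded x_def]] by blast
  with assms(1) have agree: "E \<inter> {..<m} = D \<inter> {..<m}" if "m \<le> x" for m
    using that by auto
  let ?l = "anchor D x"
  have l: "?l \<le> x" by (rule anchor_le)
  have x_less: "x < anchor D i" using xy y(2) by simp
  have "x < anchor E k"
  proof (rule ccontr)
    assume "\<not> x < anchor E k"
    moreover have xk: "x \<le> k" using x_less anchor_le[of D i] assms(2) by simp
    ultimately have "anchor E x = anchor E k" using anchor_between[of E k x] by simp
    moreover have Ex: "anchor E x = ?l" using anchor_cong agree by blast
    moreover obtain r where r: "x < r" "r \<le> anchor D i"
      "refuted (D \<inter> {..<?l}) ?l (D \<inter> {..<r}) r"
      using anchor_changed[of x i D] x_less l anchor_le[of D i] by fastforce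
    moreover have "r \<le> k" using r(2) anchor_le[of D i] assms(2) by simp
    ultimately have "\<not> refuted (E \<inter> {..<?l}) ?l (E \<inter> {..<r}) r"
      using anchor_unchanged[of E k x r] by simp
    moreover have "E \<inter> {..<?l} = D \<inter> {..<?l}" using agree l by blast
    moreover have "D \<inter> {..<r} \<subseteq> E \<inter> {..<r}" using assms(1) by blast
    ultimately show False using r(3) refuted_mono by metis
  qed
  with x_less xED show ?thesis by blast
qed

section \<open>Node changes and the absence of returns\<close>

text \<open>The core of \<open>Wb\<close>: the datum missing from the earlier hypothesis is found
  already in the base of the later node.\<close>

lemma node_changed:
  assumes "D \<subseteq> E" "i \<le> k" "node D i \<noteq> node E k"
  shows "\<not> fst (node E k) \<subseteq> case_prod hyp (node D i)"
proof (cases "E \<inter> {..<anchor D i} = D \<inter> {..<anchor D i}")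
  case True
  \<comment> \<open>The path of \<open>E\<close> runs through the node of \<open>D\<close> and
    leaves it by a refutation at some \<open>r\<close>. As \<open>r \<le> anchor E k\<close>, the
    refuting data belong to the new base.\<close>
  let ?j = "anchor D i"
  have j: "anchor E ?j = ?j" using True by (rule anchor_agree)
  moreover have "anchor E k \<noteq> ?j" using True assms(3) unfolding node_def by metis
  ultimately obtain r where r: "r \<le> anchor E k" "refuted (E \<inter> {..<?j}) ?j (E \<inter> {..<r}) r"
    using anchor_changed[of ?j k E] anchor_le[of D i] assms(2) by fastforce
  then have "\<not> E \<inter> {..<r} \<subseteq> hyp (D \<inter> {..<?j}) ?j"
    using refuted_sound[of "E \<inter> {..<r}"] True by simp
  with r(1) show ?thesis by (auto simp: node_def)
next
  case False
  \<comment> \<open>The new datum \<open>x\<close> is excluded from the old hypothesis, which adds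
    nothing below its anchor, and it lies in the new base because it is below the new anchor
    too.\<close>
  then obtain x where "x < anchor D i" "x < anchor E k" "x \<in> E" "x \<notin> D"
    using anchor_above_new_element[OF assms(1,2)] by blast
  with hyp_below[of "D \<inter> {..<anchor D i}" "anchor D i"] show ?thesis by (auto simp: node_def)
qed

text \<open>\<open>Wb\<close> compares \<open>n\<close> with \<open>m\<close> after any change in
  between, so returning to an earlier node must be ruled out. A refutation that makes
  \<open>F\<close> leave the node would be seen on the larger data \<open>E\<close> as well.\<close>

lemma node_no_return:
  assumes "D \<subseteq> F" "F \<subseteq> E" "i \<le> l" "l \<le> k" "node D i = node E k"
  shows "node F l = node D i"
proof -
  let ?j = "anchor D i"
  have E: "E \<inter> {..<?j} = D \<inter> {..<?j}" "anchor E k = ?j" using assms(5) unfolding node_def by (metis prod.inject)+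
  with assms(1,2) have F: "F \<inter> {..<?j} = D \<inter> {..<?j}" by blast
  have Fj: "anchor F ?j = ?j" and Ej: "anchor E ?j = ?j"
    using F E(1) by (blast intro: anchor_agree)+
  have "anchor F l = ?j"
  proof (rule ccontr)
    assume "anchor F l \<noteq> ?j"
    with Fj obtain r where r: "?j < r" "r \<le> anchor F l" "refuted (F \<inter> {..<?j}) ?j (F \<inter> {..<r}) r"
      using anchor_changed[of ?j l F] anchor_le[of D i] assms(3) by fastforce
    have "r \<le> k" using r(2) anchor_le[of F l] assms(4) by simp
    then have "\<not> refuted (E \<inter> {..<?j}) ?j (E \<inter> {..<r}) r"
      using anchor_unchanged[of E k ?j r] E(2) Ej r(1) by simp
    moreover have "F \<inter> {..<r} \<subseteq> E \<inter> {..<r}" using assms(2) by blast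
    ultimately show False using r(3) refuted_mono E(1) F by metis
  qed
  with F show ?thesis by (simp add: node_def)
qed

section \<open>Convergence on languages of the given learner\<close>

text \<open>The properties of the given learner that the convergence proof relies on: definedness on
  data from \<open>L\<close>, caution, and a locking property stated for data sets instead of
  sequences.\<close>

definition learns :: "nat set \<Rightarrow> bool" where
  "learns L \<longleftrightarrow>
     (\<forall>D j. D \<subseteq> L \<inter> {..<j} \<longrightarrow> (\<exists>t. a D j t \<noteq> 0)) \<and>
     (\<forall>D j t. D \<subseteq> L \<inter> {..<j} \<longrightarrow> a D j t \<noteq> 0 \<longrightarrow> \<not> L \<subset> enum (a D j t - 1)) \<and>
     (\<exists>j0 e. enum e = L \<and> (\<forall>j\<ge>j0. \<forall>D t. L \<inter> {..<j0} \<subseteq> D \<longrightarrow> D \<subseteq> L \<inter> {..<j} \<longrightarrow>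
        a D j t \<noteq> 0 \<longrightarrow> a D j t = Suc e))"

lemma learns_total: "learns L \<Longrightarrow> D \<subseteq> L \<inter> {..<j} \<Longrightarrow> \<exists>t. a D j t \<noteq> 0"
  by (simp add: learns_def)

lemma learns_cautious:
  "learns L \<Longrightarrow> D \<subseteq> L \<inter> {..<j} \<Longrightarrow> a D j t = Suc e \<Longrightarrow> \<not> L \<subset> enum e"
  by (metis diff_Suc_1 learns_def nat.distinct(1))

lemma learns_lock:
  assumes "learns L"
  obtains j0 e where "enum e = L" "\<And>j D t. j0 \<le> j \<Longrightarrow> L \<inter> {..<j0} \<subseteq> D \<Longrightarrow>
      D \<subseteq> L \<inter> {..<j} \<Longrightarrow> a D j t \<noteq> 0 \<Longrightarrow> a D j t = Suc e"
proof -
  from assms obtain j0 e where "enum e = L" and lock: "\<forall>j\<ge>j0. \<forall>D t. L \<inter> {..<j0} \<subseteq> D \<longrightarrow>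
      D \<subseteq> L \<inter> {..<j} \<longrightarrow> a D j t \<noteq> 0 \<longrightarrow> a D j t = Suc e"
    unfolding learns_def by (elim conjE exE)
  from this(1) show ?thesis by (rule that[of e j0]) (use lock in blast)
qed

text \<open>Once the guess \<open>e\<close> is available and \<open>C\<close> together with
  \<open>x\<close> has been enumerated, permanent stability makes the stage sound.\<close>

lemma hyp_eq_target:
  assumes stb: "\<And>t. stable C j {} t" and t0: "a C j t0 = Suc e"
    and C: "finite C" "C \<subseteq> enum e"
  shows "enum e \<subseteq> hyp C j"
proof
  fix x
  assume "x \<in> enum e"
  with C have "\<exists>t. \<forall>y\<in>insert x C. u e y t"
  proof (induction C rule: finite_induct)
    case empty
    then show ?case by (auto simp: enum_def)
  next
    case (insert z C)
    then obtain t t' where "\<forall>y\<in>Set.insert x C. u e y t" "u e z t'" by (auto simp: enum_def)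
    then have "\<forall>y\<in>Set.insert x (Set.insert z C). u e y (max t t')"
      using u_mono[of e _ t "max t t'"] u_mono[of e z t' "max t t'"] by auto
    then show ?case ..
  qed
  then obtain t where t: "\<forall>y\<in>insert x C. u e y t" ..
  define s where "s = max t t0"
  have "\<forall>y\<in>insert x C. u e y s" "a C j s = Suc e"
    using t u_mono[of e _ t s] t0 a_stable[of C j t0 s] by (auto simp: s_def)
  with stb have "sound C j s" "x \<in> cand C j s" by (auto simp: sound_def cand_def)
  then show "x \<in> hyp C j" by (auto simp: hyp_def)
qed

text \<open>Past the lock, all sets compared in \<open>stable\<close> lie between the locking data
  and \<open>L\<close>. They all give the index \<open>e\<close>, so no mind change ever shows
  up.\<close>

lemma learns_hyp_eventually:
  assumes "learns L"
  shows "\<exists>j0. \<forall>j\<ge>j0. hyp (L \<inter> {..<j}) j = L"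
proof -
  obtain j0 e where e: "enum e = L" and
    lock: "\<And>j D t. j0 \<le> j \<Longrightarrow> L \<inter> {..<j0} \<subseteq> D \<Longrightarrow> D \<subseteq> L \<inter> {..<j} \<Longrightarrow>
      a D j t \<noteq> 0 \<Longrightarrow> a D j t = Suc e" by (rule learns_lock[OF assms]) blast
  have "hyp (L \<inter> {..<j}) j = L" if j: "j0 \<le> j" for j
  proof -
    let ?C = "L \<inter> {..<j}"
    have base: "L \<inter> {..<j0} \<subseteq> ?C" using j by auto
    have a: "a ?C j t \<noteq> 0 \<Longrightarrow> a ?C j t = Suc e" for t using lock[OF j base] by blast
    have cand: "cand ?C j t \<subseteq> L" for t using a[of t] e by (auto simp: cand_def enum_def)
    have "stable ?C j {} t" for t
      unfolding stable_def
    proof (intro conjI allI impI)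
      show "({} \<union> cand ?C j t) \<inter> {..<j} \<subseteq> ?C" using cand by auto
      fix k E
      assume "j \<le> k" "E \<subseteq> {..<k}" "?C \<subseteq> E \<and> E \<subseteq> {} \<union> cand ?C j t"
      moreover from this have "a E k t \<noteq> 0 \<Longrightarrow> a E k t = Suc e"
        using j base cand[of t] by (intro lock) auto
      ultimately show "a E k t = 0 \<or> a ?C j t = 0 \<or> a E k t = a ?C j t" using a[of t] by auto
    qed
    moreover obtain t where "a ?C j t \<noteq> 0" using learns_total[OF assms subset_refl] by blast
    ultimately have "L \<subseteq> hyp ?C j" using hyp_eq_target[of ?C j t e] a[of t] e by simp
    moreover have "hyp ?C j \<subseteq> L" using cand by (auto simp: hyp_def)
    ultimately show ?thesis by blast
  qed
  then show ?thesis by blast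
qed

text \<open>Exceeding \<open>L\<close> means exceeding the base, so some stage is sound and the
  whole hypothesis lies inside the set guessed on \<open>L \<inter> {..<j}\<close>. That guess would
  properly contain \<open>L\<close>, against caution.\<close>

lemma learns_not_overgeneralizing:
  assumes "learns L"
  shows "\<not> L \<subset> hyp (L \<inter> {..<j}) j"
proof
  let ?C = "L \<inter> {..<j}"
  assume L: "L \<subset> hyp ?C j"
  then obtain t where t: "sound ?C j t" by (auto simp: hyp_def)
  define e where "e = a ?C j t - 1"
  have e: "a ?C j t = Suc e" using t by (simp add: sound_def e_def)
  have "a ?C j s \<noteq> 0 \<Longrightarrow> a ?C j s = Suc e" for s
    using a_stable[of ?C j s t] a_stable[of ?C j t s] e by (cases "s \<le> t") auto
  then have "cand ?C j s \<subseteq> ?C \<union> enum e" for s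
    unfolding cand_def enum_def by fastforce
  moreover have "?C \<subseteq> enum e" using t e by (auto simp: sound_def enum_def)
  ultimately have "hyp ?C j \<subseteq> enum e" by (auto simp: hyp_def)
  with L have "L \<subset> enum e" by blast
  with learns_cautious[OF assms subset_refl e] show False by blast
qed

lemma learns_refuted:
  assumes L: "learns L" and unref: "\<And>k. k0 < k \<Longrightarrow> \<not> refuted (L \<inter> {..<j}) j (L \<inter> {..<k}) k"
  shows "hyp (L \<inter> {..<j}) j = L"
proof (rule ccontr)
  let ?C = "L \<inter> {..<j}"
  assume "hyp ?C j \<noteq> L"
  then obtain x where x: "x \<in> L" "x \<notin> hyp ?C j"
    using learns_not_overgeneralizing[OF L, of j] by blast
  \<comment> \<open>With \<open>x\<close> among the data, the first two conditions of
    \<open>refuted\<close> hold, so only stability can prevent a refutation.\<close>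
  have stb: "stable ?C j (L \<inter> {..<k}) k" if "max k0 x < k" for k
  proof -
    have "x \<in> L \<inter> {..<k}" using x that by simp
    with x(2) unref[of k] that show ?thesis by (auto simp: refuted_def hyp_def)
  qed
  obtain j0 e where e: "enum e = L" and
    lock: "\<And>j D t. j0 \<le> j \<Longrightarrow> L \<inter> {..<j0} \<subseteq> D \<Longrightarrow> D \<subseteq> L \<inter> {..<j} \<Longrightarrow>
      a D j t \<noteq> 0 \<Longrightarrow> a D j t = Suc e" by (rule learns_lock[OF L]) blast
  \<comment> \<open>Level \<open>k\<close> is past the lock, so the guess on \<open>?E\<close> is
    \<open>e\<close>; stability will force the same guess on \<open>?C\<close>.\<close>
  define k where "k = max j0 j"
  let ?E = "L \<inter> {..<k}"
  obtain s t where s: "a ?E k s \<noteq> 0" and t: "a ?C j t \<noteq> 0"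
    using learns_total[OF L subset_refl] by blast
  \<comment> \<open>At stage \<open>m\<close> both computations have halted, level \<open>k\<close>
    is among those compared, and \<open>stb\<close> applies.\<close>
  define m where "m = Suc (Max {s, t, k, k0, x})"
  have m: "s \<le> m" "t \<le> m" "k \<le> m" "max k0 x < m" by (auto simp: m_def)
  have "a ?E k m \<noteq> 0" "a ?C j m \<noteq> 0"
    using s t a_stable[OF s m(1)] a_stable[OF t m(2)] by auto
  moreover have "a ?E k m = 0 \<or> a ?C j m = 0 \<or> a ?E k m = a ?C j m"
  proof -
    have "j \<le> k" "?E \<subseteq> {..<k}" "?C \<subseteq> ?E \<and> ?E \<subseteq> L \<inter> {..<m} \<union> cand ?C j m"
      using m(3) by (auto simp: k_def)
    with stb[OF m(4)] m(3) show ?thesis unfolding stable_def by blast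
  qed
  moreover have "a ?E k m \<noteq> 0 \<Longrightarrow> a ?E k m = Suc e"
    by (rule lock) (auto simp: k_def)
  ultimately have "a ?C j m = Suc e" by simp
  moreover have "stable ?C j {} r" for r
    by (rule stable_antimono[OF stb[of "Suc (max r (max k0 x))"]]) auto
  ultimately have "L \<subseteq> hyp ?C j" using hyp_eq_target[of ?C j m e] e by auto
  with x show False by blast
qed

text \<open>Either the anchor reaches \<open>j0\<close>, where the hypothesis is correct and hence
  never refuted, or it is monotone and bounded.\<close>

lemma learns_anchor_converges:
  assumes L: "learns L"
  shows "\<exists>k0. \<forall>k\<ge>k0. anchor L k = anchor L k0"
proof -
  obtain j0 where j0: "\<And>j. j0 \<le> j \<Longrightarrow> hyp (L \<inter> {..<j}) j = L"
    using learns_hyp_eventually[OF L] by blast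
  show ?thesis
  proof (cases "\<exists>k. j0 \<le> anchor L k")
    case True
    then obtain k where "j0 \<le> anchor L k" ..
    then have "hyp (L \<inter> {..<anchor L k}) (anchor L k) = L" by (rule j0)
    then have "\<not> refuted (L \<inter> {..<anchor L k}) (anchor L k) (L \<inter> {..<n}) n" for n
      using refuted_sound[of "L \<inter> {..<n}" "L \<inter> {..<anchor L k}"] by fastforce
    then show ?thesis using anchor_changed[of k _ L] by blast
  next
    case False
    then show ?thesis
      by (intro bounded_mono_eventually_const[of _ j0]) (auto simp: mono_def anchor_mono not_le intro: less_imp_le)
  qed
qed

text \<open>Data from \<open>L\<close> that agree with \<open>L\<close> below \<open>k0\<close> lead
  to the final node. A later refutation by such data would also be one by \<open>L\<close>, which
  sees none after \<open>k0\<close>.\<close>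

theorem learns_node_converges:
  assumes L: "learns L"
  shows "\<exists>k0 j. hyp (L \<inter> {..<j}) j = L \<and>
    (\<forall>D i. D \<subseteq> L \<longrightarrow> L \<inter> {..<k0} \<subseteq> D \<longrightarrow> k0 \<le> i \<longrightarrow> node D i = (L \<inter> {..<j}, j))"
proof -
  obtain k0 where k0: "\<And>k. k0 \<le> k \<Longrightarrow> anchor L k = anchor L k0"
    using learns_anchor_converges[OF L] by blast
  let ?j = "anchor L k0"
  have unref: "\<not> refuted (L \<inter> {..<?j}) ?j (L \<inter> {..<k}) k" if "k0 < k" for k
    using anchor_unchanged[of L k k0 k] k0[of k] that by simp
  have "node D i = (L \<inter> {..<?j}, ?j)" if D: "D \<subseteq> L" "L \<inter> {..<k0} \<subseteq> D" and i: "k0 \<le> i" for D i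
  proof -
    have agree: "D \<inter> {..<k} = L \<inter> {..<k}" if "k \<le> k0" for k using D that by auto
    have Dk0: "anchor D k0 = ?j" using agree by (intro anchor_cong) simp
    have base: "D \<inter> {..<?j} = L \<inter> {..<?j}" using agree anchor_le by blast
    have "anchor D i = ?j"
    proof (rule ccontr)
      assume "anchor D i \<noteq> ?j"
      then obtain k where k: "k0 < k" "refuted (L \<inter> {..<?j}) ?j (D \<inter> {..<k}) k"
        using anchor_changed[OF i, of D] Dk0 base by auto
      have "D \<inter> {..<k} \<subseteq> L \<inter> {..<k}" using D(1) by blast
      with k unref refuted_mono show False by blast
    qed
    with base show ?thesis by (simp add: node_def)
  qed
  with learns_refuted[OF L unref] show ?thesis by blast
qed

end


section \<open>Texts and locking sequences\<close>

definition list_content :: "nat option list \<Rightarrow> nat set" where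
  "list_content \<sigma> = {x. Some x \<in> set \<sigma>}"

lemma list_content_append [simp]: "list_content (\<sigma> @ \<rho>) = list_content \<sigma> \<union> list_content \<rho>"
  by (auto simp: list_content_def)

lemma finite_list_content [simp]: "finite (list_content \<sigma>)"
  unfolding list_content_def by (rule finite_inverse_image) auto

lemma content_init_eq_list_content: "content_init T n = list_content (map T [0..<n])"
  unfolding content_init_def list_content_def set_map set_upt by (auto intro: rev_image_eqI)

lemma finite_content_init [simp]: "finite (content_init T n)"
  by (simp add: content_init_eq_list_content)

lemma content_init_mono: "m \<le> n \<Longrightarrow> content_init T m \<subseteq> content_init T n"
  by (auto simp: content_init_def intro: less_le_trans)

lemma content_init_subset: "content_init T n \<subseteq> content T"
  by (auto simp: content_init_def content_def)

lemma content_init_eventually_superset: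
  assumes "finite D" "D \<subseteq> content T"
  shows "\<exists>n. D \<subseteq> content_init T n"
  using assms
proof (induction D rule: finite_induct)
  case (insert x D)
  then obtain n i where n: "D \<subseteq> content_init T n" "T i = Some x" by (auto simp: content_def)
  then have "x \<in> content_init T (max n (Suc i))" by (auto simp: content_init_def intro!: exI[of _ i])
  with n(1) content_init_mono[of n "max n (Suc i)" T] show ?case by auto
qed simp

lemma text_extending_list:
  assumes "list_content \<sigma> \<subseteq> L"
  obtains T where "T \<in> Txt L" "map T [0..<length \<sigma>] = \<sigma>"
proof
  \<comment> \<open>The prefix is followed by \<open>L\<close> in increasing order, with pauses at
    nonelements; this also works for finite or empty \<open>L\<close>.\<close>
  let ?T = "\<lambda>i. if i < length \<sigma> then \<sigma> ! i
    else if i - length \<sigma> \<in> L then Some (i - length \<sigma>) else None"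
  show "map ?T [0..<length \<sigma>] = \<sigma>" by (rule nth_equalityI) auto
  have "x \<in> content ?T" if "x \<in> L" for x
    using that unfolding content_def by (auto intro!: exI[of _ "x + length \<sigma>"])
  moreover have "x \<in> L" if "?T i = Some x" for x i
  proof (cases "i < length \<sigma>")
    case True
    with that nth_mem[OF True] have "x \<in> list_content \<sigma>" by (simp add: list_content_def)
    with assms show ?thesis by blast
  qed (use that in \<open>auto split: if_splits\<close>)
  ultimately show "?T \<in> Txt L" unfolding Txt_def content_def by blast
qed

text \<open>Repeating elements of \<sigma> is harmless, so \<open>card D\<close> further positions
  suffice and pauses fill the rest.\<close>

lemma list_with_content:
  assumes "finite D" "list_content \<sigma> \<subseteq> D" "length \<sigma> + card D \<le> n"
  obtains \<rho> where "length (\<sigma> @ \<rho>) = n" "list_content (\<sigma> @ \<rho>) = D"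
proof
  let ?\<rho> = "map Some (sorted_list_of_set D) @ replicate (n - length \<sigma> - card D) None"
  show "length (\<sigma> @ ?\<rho>) = n" using assms by simp
  have "list_content ?\<rho> = D" using assms(1) by (auto simp: list_content_def)
  then show "list_content (\<sigma> @ ?\<rho>) = D" using assms(2) by auto
qed

definition on_list :: "(nat \<Rightarrow> nat option) \<Rightarrow> nat option list \<Rightarrow> nat option" where
  "on_list h \<sigma> = h (prod_encode (set_code (list_content \<sigma>), length \<sigma>))"

lemma Psd_eq_on_list: "Psd h T n = on_list h (map T [0..<n])"
  by (simp add: Psd_def on_list_def content_init_eq_list_content)

text \<open>Entry \<open>i\<close> can be read from \<open>f (Suc i)\<close>, which is longer than
  \<open>i\<close>; any two members are comparable as prefixes.\<close>

lemma limit_text: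
  assumes prefix: "\<And>n. \<exists>\<rho>. f (Suc n) = f n @ \<rho>" and len: "\<And>n. n \<le> length (f n)"
  shows "map (\<lambda>i. f (Suc i) ! i) [0..<length (f n)] = f n"
proof (rule nth_equalityI)
  have mono: "\<exists>\<rho>. f n = f m @ \<rho>" if "m \<le> n" for m n
    using that
  proof (induction n rule: dec_induct)
    case (step n)
    then show ?case using prefix[of n] by (metis append.assoc)
  qed simp
  fix i
  assume "i < length (map (\<lambda>i. f (Suc i) ! i) [0..<length (f n)])"
  then have i: "i < length (f n)" "i < length (f (Suc i))" using len[of "Suc i"] by simp_all
  have "(\<exists>\<rho>. f n = f (Suc i) @ \<rho>) \<or> (\<exists>\<rho>. f (Suc i) = f n @ \<rho>)"
    using mono[of n "Suc i"] mono[of "Suc i" n] nat_le_linear by blast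
  then have "f (Suc i) ! i = f n ! i" using i by (metis nth_append)
  with i show "map (\<lambda>i. f (Suc i) ! i) [0..<length (f n)] ! i = f n ! i" by simp
qed simp

text \<open>The Blum--Blum argument: otherwise, alternating extensions on which the hypothesis changes
  with the elements of \<open>L\<close> yields a text for \<open>L\<close> on which \<open>h\<close> does not converge.\<close>

lemma locking_list:
  assumes total: "\<And>T. T \<in> Txt L \<Longrightarrow> total_seq (Psd h T)"
    and ex: "\<And>T. T \<in> Txt L \<Longrightarrow> Ex \<phi> (the \<circ> Psd h T) T"
  obtains \<sigma> e where "list_content \<sigma> \<subseteq> L" "W \<phi> e = L"
    "\<And>\<rho>. list_content \<rho> \<subseteq> L \<Longrightarrow> on_list h (\<sigma> @ \<rho>) = Some e"
proof -
  have "\<exists>\<sigma>. list_content \<sigma> \<subseteq> L \<and> (\<forall>\<rho>. list_content \<rho> \<subseteq> L \<longrightarrow> on_list h (\<sigma> @ \<rho>) = on_list h \<sigma>)"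
  proof (rule ccontr)
    assume "\<not> ?thesis"
    then obtain r where r: "\<And>\<sigma>. list_content \<sigma> \<subseteq> L \<Longrightarrow>
        list_content (r \<sigma>) \<subseteq> L \<and> on_list h (\<sigma> @ r \<sigma>) \<noteq> on_list h \<sigma>"
      by metis
    define g where "g n = (if n \<in> L then Some n else None)" for n
    define f where "f = rec_nat [] (\<lambda>n \<sigma>. \<sigma> @ r \<sigma> @ [g n])"
    have f: "f 0 = []" "f (Suc n) = f n @ r (f n) @ [g n]" for n by (simp_all add: f_def)
    have sub: "list_content (f n) \<subseteq> L" for n
    proof (induction n)
      case (Suc n)
      moreover have "list_content [g n] \<subseteq> L" by (auto simp: list_content_def g_def)
      ultimately show ?case using r by (simp add: f(2))
    qed (simp add: f list_content_def)
    have len: "n \<le> length (f n)" for n by (induction n) (auto simp: f)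
    define T where "T i = f (Suc i) ! i" for i
    have T: "map T [0..<length (f n)] = f n" for n
      unfolding T_def by (rule limit_text) (use f len in auto)
    have "content_init T (length (f n)) \<subseteq> L" for n
      using sub T by (simp add: content_init_eq_list_content)
    then have "content_init T n \<subseteq> L" for n
      using content_init_mono[OF len] by blast
    then have "content T \<subseteq> L" using content_init_eventually_superset[of "{_}" T] by blast
    moreover have "L \<subseteq> content T"
    proof
      fix x
      assume "x \<in> L"
      then have "x \<in> list_content (f (Suc x))" by (simp add: f(2) g_def list_content_def)
      then have "x \<in> content_init T (length (f (Suc x)))"
        using T by (simp add: content_init_eq_list_content)
      then show "x \<in> content T" using content_init_subset by blast
    qed
    ultimately have TL: "T \<in> Txt L" by (auto simp: Txt_def)
    obtain n where n: "\<And>m. n \<le> m \<Longrightarrow> the (Psd h T m) = the (Psd h T n)"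
      using ex[OF TL] by (auto simp: Ex_def)
    have Psd_const: "Psd h T m = Psd h T n" if "n \<le> m" for m
      using n[OF that] total[OF TL] unfolding total_seq_def by (metis option.expand)
    have const: "on_list h (map T [0..<m]) = on_list h (map T [0..<n])" if "n \<le> m" for m
      using Psd_const[OF that] by (simp only: Psd_eq_on_list)
    \<comment> \<open>The intermediate list is an initial segment of \<open>T\<close> too, so both
      sides of the mind change at \<open>f n\<close> fall after convergence.\<close>
    have ext: "map T [0..<length (f n @ r (f n))] = f n @ r (f n)"
    proof -
      have "take (length (f n @ r (f n))) (map T [0..<length (f (Suc n))]) = f n @ r (f n)"
        unfolding T by (simp add: f(2))
      then show ?thesis by (simp add: take_map f(2) min_def)
    qed
    have "on_list h (f n) = on_list h (map T [0..<n])"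
      using const[OF len] unfolding T .
    moreover have "on_list h (f n @ r (f n)) = on_list h (map T [0..<n])"
      using const[of "length (f n @ r (f n))"] len[of n] unfolding ext by simp
    ultimately show False using r[OF sub[of n]] by simp
  qed
  then obtain \<sigma> where \<sigma>: "list_content \<sigma> \<subseteq> L"
    and lock: "\<And>\<rho>. list_content \<rho> \<subseteq> L \<Longrightarrow> on_list h (\<sigma> @ \<rho>) = on_list h \<sigma>" by blast
  \<comment> \<open>Locking gives only constancy. A text for \<open>L\<close> through \<sigma> shows
    that the constant guess is defined and correct.\<close>
  obtain T where T: "T \<in> Txt L" "map T [0..<length \<sigma>] = \<sigma>" using text_extending_list[OF \<sigma>] .
  have Psd: "Psd h T n = on_list h \<sigma>" if "length \<sigma> \<le> n" for n
  proof -
    have "map T [0..<n] = \<sigma> @ map T [length \<sigma>..<n]"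
      using T(2) that by (metis le_add_diff_inverse map_append upt_add_eq_append zero_le)
    moreover have "list_content (map T [length \<sigma>..<n]) \<subseteq> L"
      using T(1) by (auto simp: list_content_def Txt_def content_def image_iff)
    ultimately show ?thesis using lock by (simp add: Psd_eq_on_list)
  qed
  obtain e where e: "on_list h \<sigma> = Some e"
    using total[OF T(1)] Psd[OF order_refl] unfolding total_seq_def by (metis not_None_eq)
  obtain n where n: "\<And>m. n \<le> m \<Longrightarrow> the (Psd h T m) = the (Psd h T n) \<and> W \<phi> (the (Psd h T n)) = L"
    using ex[OF T(1)] T(1) by (auto simp: Ex_def Txt_def)
  have "W \<phi> e = L"
    using n[of "max n (length \<sigma>)"] Psd[of "max n (length \<sigma>)"] e by simp
  with \<sigma> show ?thesis using that lock e by simp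
qed

lemma finite_subset_lessThan: "finite A \<Longrightarrow> \<exists>n. A \<subseteq> {..<n::nat}"
  by (auto simp: finite_nat_set_iff_bounded)

text \<open>The factor in \<open>2 * j\<close> makes room: a set \<open>D\<close> below
  \<open>j\<close> has at most \<open>j\<close> elements, so for \<open>j\<close> at least the
  length of the locking list, that list can be extended to length \<open>2 * j\<close> with content
  exactly \<open>D\<close>. Hence every such pair is an input on some text for \<open>L\<close>, and
  locking applies to it.\<close>

lemma approximated_learner_learns:
  assumes A: "approximates A h" and U: "approximates U (\<lambda>x. \<phi> (p1 x) (p2 x))"
    and h: "TxtPsdEx_learns \<phi> (CautTar \<phi>) h L"
  defines "a \<equiv> \<lambda>D j t. A (prod_encode (set_code D, 2 * j)) t"
    and "u \<equiv> \<lambda>e x t. U (prod_encode (e, x)) t \<noteq> 0"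
  shows "approximated_learner.learns a u L"
proof -
  interpret approximated_learner a u
  proof
    show "a D j t' = a D j t" if "a D j t \<noteq> 0" "t \<le> t'" for D j t t'
      using that approximates_stable[OF A] unfolding a_def by blast
    show "u e x t'" if "u e x t" "t \<le> t'" for e x t t'
      using that approximates_stable[OF U] unfolding u_def by metis
  qed
  have enum: "enum e = W \<phi> e" for e
  proof -
    have "\<phi> e x \<noteq> None \<longleftrightarrow> (\<exists>t. U (prod_encode (e, x)) t \<noteq> 0)" for x
      using approximates_iff[OF U, of "prod_encode (e, x)"]
      by (metis fst_conv not0_implies_Suc not_None_eq old.nat.distinct(2) prod_encode_inverse snd_conv)
    then show ?thesis unfolding enum_def by (simp only: W_def u_def)
  qed
  have Psd_total: "total_seq (Psd h T)" and Psd_caut: "CautTar \<phi> (the \<circ> Psd h T) T"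
    and Psd_ex: "Ex \<phi> (the \<circ> Psd h T) T" if "T \<in> Txt L" for T
    using h that by (auto simp: TxtPsdEx_learns_def)
  have defined: "\<exists>e. h (prod_encode (set_code D, 2 * j)) = Some e \<and> \<not> L \<subset> W \<phi> e"
    if D: "D \<subseteq> L \<inter> {..<j}" for D j
  proof -
    have fin: "finite D" "card D \<le> j"
      using D card_mono[of "{..<j}" D] finite_subset[of D "{..<j}"] by auto
    have "list_content [] \<subseteq> D" "length [] + card D \<le> 2 * j"
      using fin(2) by (auto simp: list_content_def)
    then obtain \<rho> where \<rho>: "length \<rho> = 2 * j" "list_content \<rho> = D"
      using list_with_content[OF fin(1)] by (metis append_Nil)
    then have "list_content \<rho> \<subseteq> L" using D by auto
    then obtain T where T: "T \<in> Txt L" "map T [0..<length \<rho>] = \<rho>" by (rule text_extending_list)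
    have "Psd h T (2 * j) = h (prod_encode (set_code D, 2 * j))"
      using T(2) \<rho> by (simp add: Psd_eq_on_list on_list_def)
    moreover have "Psd h T (2 * j) \<noteq> None" using Psd_total[OF T(1)] unfolding total_seq_def by blast
    moreover have "\<not> L \<subset> W \<phi> (the (Psd h T (2 * j)))"
      using Psd_caut[OF T(1)] T(1) by (simp add: CautTar_def Txt_def)
    ultimately show ?thesis by auto
  qed
  have a_value: "a D j t = Suc e \<Longrightarrow> h (prod_encode (set_code D, 2 * j)) = Some e" for D j t e
    using approximates_iff[OF A] unfolding a_def by blast
  obtain \<sigma> e where \<sigma>: "list_content \<sigma> \<subseteq> L" "W \<phi> e = L"
    and lock: "\<And>\<rho>. list_content \<rho> \<subseteq> L \<Longrightarrow> on_list h (\<sigma> @ \<rho>) = Some e"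
    using locking_list[OF Psd_total Psd_ex] by metis
  obtain n where n: "list_content \<sigma> \<subseteq> {..<n}"
    using finite_subset_lessThan[OF finite_list_content] by blast
  define j0 where "j0 = max n (length \<sigma>)"
  have locked: "h (prod_encode (set_code D, 2 * j)) = Some e"
    if j: "j0 \<le> j" and D: "L \<inter> {..<j0} \<subseteq> D" "D \<subseteq> L \<inter> {..<j}" for j D
  proof -
    have fin: "finite D" "card D \<le> j"
      using D card_mono[of "{..<j}" D] finite_subset[of D "{..<j}"] by auto
    have "{..<n} \<subseteq> {..<j0}" by (auto simp: j0_def)
    with \<sigma>(1) n have "list_content \<sigma> \<subseteq> L \<inter> {..<j0}" by (meson le_inf_iff order_trans)
    with D(1) have "list_content \<sigma> \<subseteq> D" by (rule order_trans[rotated])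
    moreover have "length \<sigma> + card D \<le> 2 * j" using fin(2) j by (simp add: j0_def)
    ultimately obtain \<rho> where \<rho>: "length (\<sigma> @ \<rho>) = 2 * j" "list_content (\<sigma> @ \<rho>) = D"
      using list_with_content[OF fin(1)] by blast
    then have "on_list h (\<sigma> @ \<rho>) = Some e" using D(2) by (intro lock) auto
    then show ?thesis using \<rho> by (simp add: on_list_def)
  qed
  show ?thesis
    unfolding learns_def
  proof (intro conjI allI impI)
    show "\<exists>t. a D j t \<noteq> 0" if "D \<subseteq> L \<inter> {..<j}" for D j
      using defined[OF that] approximates_iff[OF A] unfolding a_def by (metis nat.distinct(1))
    show "\<not> L \<subset> enum (a D j t - 1)" if D: "D \<subseteq> L \<inter> {..<j}" and nz: "a D j t \<noteq> 0" for D j t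
    proof -
      have "a D j t = Suc (a D j t - 1)" using nz by simp
      from a_value[OF this] defined[OF D] show ?thesis by (auto simp: enum)
    qed
    show "\<exists>j0 e. enum e = L \<and> (\<forall>j\<ge>j0. \<forall>D t. L \<inter> {..<j0} \<subseteq> D \<longrightarrow> D \<subseteq> L \<inter> {..<j} \<longrightarrow>
        a D j t \<noteq> 0 \<longrightarrow> a D j t = Suc e)"
    proof (intro exI conjI allI impI)
      show "enum e = L" using \<sigma>(2) by (simp add: enum)
      fix j D t
      assume *: "j0 \<le> j" "L \<inter> {..<j0} \<subseteq> D" "D \<subseteq> L \<inter> {..<j}" and nz: "a D j t \<noteq> 0"
      have "a D j t = Suc (a D j t - 1)" using nz by simp
      from a_value[OF this] locked[OF *] this show "a D j t = Suc e" by simp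
    qed
  qed
qed


section \<open>Computability of the witness-based learner\<close>

lemma set_code_decode [simp]: "set_code (set_decode c) = c"
  using set_decode_inverse[of c] by (simp add: set_code_def set_encode_def)

lemma set_decode_code [simp]: "finite D \<Longrightarrow> set_decode (set_code D) = D"
  using set_encode_inverse[of D] by (simp add: set_code_def set_encode_def)

text \<open>Allows quantifiers over the elements of a coded set to be bounded by its code.\<close>

lemma set_decode_less:
  assumes "x \<in> set_decode c" shows "x < c"
proof -
  have "0 < c div 2 ^ x" using assms by (auto simp: set_decode_def intro: ccontr)
  then have "2 ^ x \<le> c" by (simp add: div_greater_zero_iff)
  with less_exp[of x] show ?thesis by linarith
qed

lemma set_decode_subset_iff: "set_decode c \<subseteq> A \<longleftrightarrow> (\<forall>x<c. x \<in> set_decode c \<longrightarrow> x \<in> A)"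
  using set_decode_less by blast

lemma set_decode_mod: "set_decode (c mod 2 ^ j) = set_decode c \<inter> {..<j}"
  by (auto simp: set_decode_def bit_take_bit_iff simp flip: bit_iff_odd take_bit_eq_mod)

lemma all_subsets_lessThan_iff:
  "(\<forall>E\<subseteq>{..<k}. P E) \<longleftrightarrow> (\<forall>e<2 ^ k. P (set_decode e))"
proof safe
  fix e :: nat
  assume P: "\<forall>E\<subseteq>{..<k}. P E" and "e < 2 ^ k"
  then have "set_decode e \<subseteq> {..<k}" using set_decode_mod[of e k] by auto
  with P show "P (set_decode e)" by blast
next
  fix E
  assume P: "\<forall>e<2 ^ k. P (set_decode e)" and E: "E \<subseteq> {..<k}"
  then have fin: "finite E" using finite_subset by blast
  \<comment> \<open>Reduction modulo \<open>2 ^ k\<close> bounds the code without changing the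
    set.\<close>
  then have "set_decode (set_code E mod 2 ^ k) = E" using E by (auto simp: set_decode_mod)
  moreover have "P (set_decode (set_code E mod 2 ^ k))" using P by simp
  ultimately show "P E" by simp
qed

locale computable_approximated_learner =
  fixes A U :: "nat \<Rightarrow> nat \<Rightarrow> nat"
  assumes A: "computable (\<lambda>z. A (p1 z) (p2 z))" and U: "computable (\<lambda>z. U (p1 z) (p2 z))"
    and A_stable: "A x t \<noteq> 0 \<Longrightarrow> t \<le> t' \<Longrightarrow> A x t' = A x t"
    and U_stable: "U x t \<noteq> 0 \<Longrightarrow> t \<le> t' \<Longrightarrow> U x t' = U x t"
begin

definition a :: "nat set \<Rightarrow> nat \<Rightarrow> nat \<Rightarrow> nat" where
  "a = (\<lambda>D j t. A (prod_encode (set_code D, 2 * j)) t)"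

definition u :: "nat \<Rightarrow> nat \<Rightarrow> nat \<Rightarrow> bool" where
  "u = (\<lambda>e x t. U (prod_encode (e, x)) t \<noteq> 0)"

sublocale approximated_learner a u
  using A_stable U_stable unfolding a_def u_def by unfold_locales metis+

lemma computable_a:
  "computable c \<Longrightarrow> computable j \<Longrightarrow> computable t \<Longrightarrow>
    computable (\<lambda>z. a (set_decode (c z)) (j z) (t z))"
  unfolding a_def set_code_decode by (rule computable_comp2[OF A]) (intro computable_intros)

lemma decidable_u:
  "computable e \<Longrightarrow> computable x \<Longrightarrow> computable t \<Longrightarrow> decidable (\<lambda>z. u (e z) (x z) (t z))"
  unfolding u_def by (intro computable_intros computable_comp2[OF U])

lemma decidable_cand:
  assumes "computable c" "computable j" "computable t" "computable x"
  shows "decidable (\<lambda>z. x z \<in> cand (set_decode (c z)) (j z) (t z))"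
  unfolding cand_def mem_Collect_eq
  by (intro computable_intros decidable_u computable_a assms)

text \<open>All quantifiers become bounded: levels by the stage, the sets \<open>E\<close> by codes
  below \<open>2 ^ k\<close>, and elements by \<open>j\<close> or by the code of their set.\<close>

lemma decidable_stable:
  assumes "computable c" "computable j" "computable d" "computable t"
  shows "decidable (\<lambda>z. stable (set_decode (c z)) (j z) (set_decode (d z)) (t z))"
proof -
  have "stable (set_decode c) j (set_decode d) t \<longleftrightarrow>
     (\<forall>x<j. x \<in> set_decode d \<or> x \<in> cand (set_decode c) j t \<longrightarrow> x \<in> set_decode c) \<and>
     (\<forall>k<Suc t. j \<le> k \<longrightarrow> (\<forall>e<2 ^ k.
        (\<forall>x<c. x \<in> set_decode c \<longrightarrow> x \<in> set_decode e) \<and>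
        (\<forall>x<e. x \<in> set_decode e \<longrightarrow> x \<in> set_decode d \<or> x \<in> cand (set_decode c) j t) \<longrightarrow>
        a (set_decode e) k t = 0 \<or> a (set_decode c) j t = 0 \<or>
        a (set_decode e) k t = a (set_decode c) j t))" for c j d t
    unfolding stable_def all_subsets_lessThan_iff set_decode_subset_iff Un_iff less_Suc_eq_le
    by blast
  moreover have "decidable (\<lambda>z. (\<forall>x<j z. x \<in> set_decode (d z) \<or>
        x \<in> cand (set_decode (c z)) (j z) (t z) \<longrightarrow> x \<in> set_decode (c z)) \<and>
     (\<forall>k<Suc (t z). j z \<le> k \<longrightarrow> (\<forall>e<2 ^ k.
        (\<forall>x<c z. x \<in> set_decode (c z) \<longrightarrow> x \<in> set_decode e) \<and>
        (\<forall>x<e. x \<in> set_decode e \<longrightarrow>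
           x \<in> set_decode (d z) \<or> x \<in> cand (set_decode (c z)) (j z) (t z)) \<longrightarrow>
        a (set_decode e) k (t z) = 0 \<or> a (set_decode (c z)) (j z) (t z) = 0 \<or>
        a (set_decode e) k (t z) = a (set_decode (c z)) (j z) (t z))))"
    by (intro computable_intros decidable_cand computable_a
        assms assms[THEN computable_comp])
  ultimately show ?thesis by simp
qed

lemma decidable_sound:
  assumes "computable c" "computable j" "computable t"
  shows "decidable (\<lambda>z. sound (set_decode (c z)) (j z) (t z))"
proof -
  have "sound (set_decode c) j t \<longleftrightarrow> a (set_decode c) j t \<noteq> 0 \<and>
     (\<forall>x<c. x \<in> set_decode c \<longrightarrow> u (a (set_decode c) j t - 1) x t) \<and>
     stable (set_decode c) j (set_decode 0) t" for c j t
    unfolding sound_def using set_decode_less by auto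
  moreover have "decidable (\<lambda>z. a (set_decode (c z)) (j z) (t z) \<noteq> 0 \<and>
     (\<forall>x<c z. x \<in> set_decode (c z) \<longrightarrow> u (a (set_decode (c z)) (j z) (t z) - 1) x (t z)) \<and>
     stable (set_decode (c z)) (j z) (set_decode 0) (t z))"
    by (intro computable_intros decidable_u decidable_stable computable_a
        assms assms[THEN computable_comp])
  ultimately show ?thesis by simp
qed

lemma decidable_refuted:
  assumes "computable c" "computable j" "computable d" "computable k"
  shows "decidable (\<lambda>z. refuted (set_decode (c z)) (j z) (set_decode (d z)) (k z))"
  unfolding refuted_def set_decode_subset_iff
  by (intro computable_intros decidable_sound decidable_cand decidable_stable
      assms assms[THEN computable_comp])

lemma computable_anchor:
  assumes "computable d" "computable n"
  shows "computable (\<lambda>z. anchor (set_decode (d z)) (n z))"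
proof -
  have "anchor (set_decode d) n = rec_nat 0 (\<lambda>n j.
     if refuted (set_decode (d mod 2 ^ j)) j (set_decode (d mod 2 ^ Suc n)) (Suc n)
     then Suc n else j) n" for d n
    by (induction n) (simp_all only: anchor.simps old.nat.simps set_decode_mod)
  moreover have "computable (\<lambda>z. rec_nat 0 (\<lambda>n j.
     if refuted (set_decode (d z mod 2 ^ j)) j (set_decode (d z mod 2 ^ Suc n)) (Suc n)
     then Suc n else j) (n z))"
    by (intro computable_rec_nat computable_intros decidable_refuted
        assms assms[THEN computable_comp])
  ultimately show ?thesis by simp
qed

text \<open>The learner needs indices computable from the node; one search program for all nodes and
  the s-m-n function supply them.\<close>

lemma hyp_index:
  assumes "acceptable \<phi>"
  obtains idx where "computable idx"
    "\<And>c j. W \<phi> (idx (prod_encode (c, j))) = hyp (set_decode c) j"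
proof -
  let ?P = "\<lambda>z t. p2 z \<in> set_decode (p1 (p1 z)) \<or>
    sound (set_decode (p1 (p1 z))) (p2 (p1 z)) t \<and>
    p2 z \<in> cand (set_decode (p1 (p1 z))) (p2 (p1 z)) t"
  have "decidable (\<lambda>y. ?P (p1 y) (p2 y))"
    by (intro computable_intros decidable_sound decidable_cand)
  then obtain f where f: "f \<in> partrec" "\<And>z. f z \<noteq> None \<longleftrightarrow> (\<exists>t. ?P z t)"
    by (rule partrec_search[of ?P]) blast
  obtain e where e: "\<phi> e = f" using assms f(1) by (auto simp: acceptable_def)
  obtain s where s: "computable s"
    "\<And>e x y. \<phi> (s (prod_encode (e, x))) y = \<phi> e (prod_encode (x, y))"
    using assms by (auto simp: acceptable_def computable_def)
  show ?thesis
  proof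
    show "computable (\<lambda>x. s (prod_encode (e, x)))"
      by (intro computable_intros computable_comp[OF s(1)])
    show "W \<phi> (s (prod_encode (e, prod_encode (c, j)))) = hyp (set_decode c) j" for c j
      using f(2)[of "prod_encode (prod_encode (c, j), x)" for x]
      by (auto simp: W_def s(2) e hyp_def)
  qed
qed

lemma node_learner:
  assumes "acceptable \<phi>"
  obtains H where "H \<in> Rfun" "\<And>T. total_seq (Psd H T)" "\<And>T. Wb \<phi> (the \<circ> Psd H T) T"
    "\<And>L T. learns L \<Longrightarrow> T \<in> Txt L \<Longrightarrow> Ex \<phi> (the \<circ> Psd H T) T"
proof -
  obtain idx where idx: "computable idx"
    "\<And>c j. W \<phi> (idx (prod_encode (c, j))) = hyp (set_decode c) j"
    by (rule hyp_index[OF assms]) blast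
  define index where "index = (\<lambda>(C, j). idx (prod_encode (set_code C, j)))"
  have W_index: "W \<phi> (index (C, j)) = hyp C j" if "finite C" for C j
    using idx(2)[of "set_code C" j] that by (simp add: index_def)
  have W_node: "W \<phi> (index (node D i)) = case_prod hyp (node D i)" for D i
    by (simp add: node_def W_index)
  define H where "H z = Some (index (node (set_decode (p1 z)) (p2 z)))" for z
  have Psd: "Psd H T i = Some (index (node (content_init T i) i))" for T i
    by (simp add: Psd_def H_def)
  show ?thesis
  proof
    \<comment> \<open>The base of a node is coded by a remainder, so the learner is computable
      directly on codes.\<close>
    have "set_code (set_decode c \<inter> {..<j}) = c mod 2 ^ j" for c j
      by (metis set_code_decode set_decode_mod)
    then have "index (node (set_decode (p1 z)) (p2 z)) = idx (prod_encode
        (p1 z mod 2 ^ anchor (set_decode (p1 z)) (p2 z), anchor (set_decode (p1 z)) (p2 z)))" for z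
      by (simp add: index_def node_def)
    moreover have "computable (\<lambda>z. idx (prod_encode
        (p1 z mod 2 ^ anchor (set_decode (p1 z)) (p2 z), anchor (set_decode (p1 z)) (p2 z))))"
      by (intro computable_intros computable_comp[OF idx(1)] computable_anchor)
    ultimately show "H \<in> Rfun" by (simp add: H_def[abs_def] Rfun_def computable_def)
    show "total_seq (Psd H T)" for T by (simp add: total_seq_def Psd)
    show "Wb \<phi> (the \<circ> Psd H T) T" for T
      unfolding Wb_def
    proof (intro allI impI)
      fix n m :: nat
      assume "\<exists>k. n \<le> k \<and> k \<le> m \<and> (the \<circ> Psd H T) n \<noteq> (the \<circ> Psd H T) k"
      then obtain k where k: "n \<le> k" "k \<le> m"
        "index (node (content_init T n) n) \<noteq> index (node (content_init T k) k)"
        by (auto simp: Psd)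
      \<comment> \<open>Different indices at \<open>n\<close> and \<open>k\<close> come from
        different nodes, and a node once left is not taken up again.\<close>
      have "node (content_init T n) n \<noteq> node (content_init T m) m"
      proof
        assume "node (content_init T n) n = node (content_init T m) m"
        from node_no_return[OF content_init_mono[OF k(1)] content_init_mono[OF k(2)] k(1,2) this]
        show False using k(3) by simp
      qed
      then have "\<not> fst (node (content_init T m) m) \<subseteq> case_prod hyp (node (content_init T n) n)"
        using k content_init_mono[of n m T] by (intro node_changed) auto
      then obtain x where x: "x \<in> fst (node (content_init T m) m)"
        "x \<notin> W \<phi> (index (node (content_init T n) n))"
        by (metis W_node subsetI)
      have "x \<in> content_init T m" using x(1) by (simp add: node_def)
      moreover have "x \<in> W \<phi> (index (node (content_init T m) m))"
        unfolding W_node using subsetD[OF base_subset_hyp x(1)] by (simp add: case_prod_beta)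
      ultimately show "content_init T m \<inter> W \<phi> ((the \<circ> Psd H T) m) - W \<phi> ((the \<circ> Psd H T) n) \<noteq> {}"
        using x(2) by (auto simp: Psd)
    qed
    show "Ex \<phi> (the \<circ> Psd H T) T" if L: "learns L" and T: "T \<in> Txt L" for L T
    proof -
      have content: "content T = L" using T by (simp add: Txt_def)
      obtain k0 j where hyp: "hyp (L \<inter> {..<j}) j = L" and conv: "\<forall>D i. D \<subseteq> L \<longrightarrow>
          L \<inter> {..<k0} \<subseteq> D \<longrightarrow> k0 \<le> i \<longrightarrow> node D i = (L \<inter> {..<j}, j)"
        using learns_node_converges[OF L] by (elim exE conjE)
      obtain n where n: "L \<inter> {..<k0} \<subseteq> content_init T n"
        using content_init_eventually_superset[of "L \<inter> {..<k0}" T] content by auto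
      have "node (content_init T i) i = (L \<inter> {..<j}, j)" if "max n k0 \<le> i" for i
        using that n content_init_mono[of n i T] content_init_subset[of T i] content
        by (intro conv[rule_format]) auto
      then have "(the \<circ> Psd H T) i = index (L \<inter> {..<j}, j)" if "max n k0 \<le> i" for i
        using that by (simp add: Psd)
      then show ?thesis
        unfolding Ex_def using W_index[of "L \<inter> {..<j}" j] hyp content
        by (intro exI[of _ "max n k0"]) simp
    qed
  qed
qed

end

section \<open>The two directions of the equivalence\<close>

lemma Wb_Ex_imp_CautTar:
  assumes "Wb \<phi> p T" "Ex \<phi> p T"
  shows "CautTar \<phi> p T"
  unfolding CautTar_def
proof (intro allI notI)
  fix n
  assume n: "content T \<subset> W \<phi> (p n)"
  obtain m where m: "\<And>k. m \<le> k \<Longrightarrow> p k = p m \<and> W \<phi> (p m) = content T"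
    using assms(2) by (auto simp: Ex_def)
  \<comment> \<open>The sets at \<open>n\<close> and at the limit differ, hence so do the indices.
    \<open>Wb\<close> then yields a datum outside a set containing all data.\<close>
  with n have "p n \<noteq> p (max n m)" by (metis max.cobounded2 psubset_eq)
  then have "(content_init T (max n m) \<inter> W \<phi> (p (max n m))) - W \<phi> (p n) \<noteq> {}"
    using assms(1) unfolding Wb_def by (metis max.cobounded1 order_refl)
  with n content_init_subset show False by blast
qed

theorem theorem5:
  fixes \<phi> :: "nat \<Rightarrow> nat \<Rightarrow> nat option"
    and \<I> :: "(nat \<Rightarrow> nat option) set"
    and \<S> :: "nat set set"
    and \<L> :: "nat set set"
  assumes "acceptable \<phi>"
    and "R_monoid \<I>"
    and "subset_closed \<S>"
  shows "(\<exists>h\<in>\<I>. (\<forall>L\<in>\<L>. TxtPsdEx_learns \<phi> (Wb \<phi>) h L)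
             \<and> (\<forall>T\<in>TxtS \<S>. total_seq (Psd h T) \<and> Wb \<phi> (the \<circ> Psd h T) T))
     \<longleftrightarrow> (\<exists>h\<in>\<I>. (\<forall>L\<in>\<L>. TxtPsdEx_learns \<phi> (CautTar \<phi>) h L)
             \<and> (\<forall>T\<in>TxtS \<S>. total_seq (Psd h T)))"
    (is "?wb \<longleftrightarrow> ?caut")
proof
  assume ?wb
  then show ?caut using Wb_Ex_imp_CautTar unfolding TxtPsdEx_learns_def by blast
next
  assume ?caut
  then obtain h where h: "h \<in> \<I>" "\<And>L. L \<in> \<L> \<Longrightarrow> TxtPsdEx_learns \<phi> (CautTar \<phi>) h L"
    by blast
  have partrec: "h \<in> partrec" "(\<lambda>x. \<phi> (p1 x) (p2 x)) \<in> partrec"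
    using assms(1,2) h(1) by (auto simp: R_monoid_def acceptable_def)
  obtain A where appr_A: "computable (\<lambda>z. A (p1 z) (p2 z))" "approximates A h"
    using partrec_approximation[OF partrec(1)] by blast
  obtain U where appr_U: "computable (\<lambda>z. U (p1 z) (p2 z))" "approximates U (\<lambda>x. \<phi> (p1 x) (p2 x))"
    using partrec_approximation[OF partrec(2)] by blast
  interpret computable_approximated_learner A U
    using appr_A(1) appr_U(1) approximates_stable[OF appr_A(2)] approximates_stable[OF appr_U(2)]
    by unfold_locales
  obtain H where H: "H \<in> Rfun" "\<And>T. total_seq (Psd H T)" "\<And>T. Wb \<phi> (the \<circ> Psd H T) T"
    "\<And>L T. learns L \<Longrightarrow> T \<in> Txt L \<Longrightarrow> Ex \<phi> (the \<circ> Psd H T) T"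
    by (rule node_learner[OF assms(1)]) blast
  have "learns L" if "L \<in> \<L>" for L
    using approximated_learner_learns[OF appr_A(2) appr_U(2) h(2)[OF that], folded a_def u_def] .
  then have "\<forall>L\<in>\<L>. TxtPsdEx_learns \<phi> (Wb \<phi>) H L"
    using H(2-4) unfolding TxtPsdEx_learns_def by blast
  \<comment> \<open>\<open>H\<close> is total computable and so belongs to every R-monoid.\<close>
  moreover have "H \<in> \<I>" using H(1) assms(2) by (auto simp: R_monoid_def)
  ultimately show ?wb using H(2,3) by blast
qed

end
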